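(* Let $1<p<\infty$, let $[X,\mathcal{B},m,\nu]$ be a reversible random walk space and let $\Omega\in\mathcal{B}$ be $m$-connected with $0<\nu(\Omega)<\nu(\Omega_m)<\infty$, and assume $\Omega$ satisfies a $p$-Poincaré inequality. Then $$T_{m,p}(\Omega)=\max_{g\in L_0^p(\Omega_m,\nu)\setminus\{0\}}\frac{\left(\int_\Omega|g|\,d\nu\right)^p}{\frac12\int_{\Omega_m\times\Omega_m}|\nabla g(x,y)|^p\,d(\nu\otimes m_x)(x,y)},$$ and the maximum is attained at $f_{\Omega,p}$.
   Context: A random walk $m$ on a measurable space $(X,\mathcal{B})$ ($\mathcal{B}$ countably generated) is a family $(m_x)_{x\in X}$ of probability measures on $\mathcal{B}$ such that $x\mapsto m_x(B)$ is measurable for each $B\in\mathcal{B}$. A $\sigma$-finite measure $\nu$ on $X$ is reversible if $dm_x(y)d\nu(x)=dm_y(x)d\nu(y)$ as measures on $X\times X$; then $[X,\mathcal{B},m,\nu]$ is called a reversible random walk space. For $A,B\in\mathcal{B}$, $L_m(A,B):=\int_A m_x(B)\,d\nu(x)$. Notation: $d(\nu\otimes m_x)(x,y)=dm_x(y)\,d\nu(x)$ and $\nabla f(x,y):=f(y)-f(x)$. For $\Omega\in\mathcal{B}$: $\partial_m\Omega:=\{x\in X\setminus\Omega: m_x(\Omega)>0\}$ and $\Omega_m:=\Omega\cup\partial_m\Omega$. A set $\Omega\in\mathcal B$ with $\nu(\Omega)>0$ is $m$-connected if $L_m(A,B)>0$ for all measurable $A,B\subset\Omega$ of positive $\nu$-measure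 with $A\cup B=\Omega$. $L^p_0(\Omega_m,\nu):=\{f\in L^p(\Omega_m,\nu): f=0\ \nu\text{-a.e. on }\partial_m\Omega\}$. $\Omega$ satisfies a $p$-Poincaré inequality if there is $\lambda>0$ with $\lambda\int_\Omega|f|^pd\nu\le\int_{\Omega_m\times\Omega_m}|\nabla f(x,y)|^p\,d(\nu\otimes m_x)(x,y)$ for all $f\in L^p_0(\Omega_m,\nu)$. The $p$-torsional function $f_{\Omega,p}\in L_0^p(\Omega_m,\nu)$ is the unique (nonnegative) solution of $$-\int_{\Omega_m}|f_{\Omega,p}(y)-f_{\Omega,p}(x)|^{p-2}(f_{\Omega,p}(y)-f_{\Omega,p}(x))\,dm_x(y)=1\ \ (\nu\text{-a.e. }x\in\Omega),\qquad f_{\Omega,p}=0\text{ on }\partial_m\Omega,$$ and the $m$-$p$-torsional rigidity is $T_{m,p}(\Omega):=\left(\int_\Omega f_{\Omega,p}\,d\nu\right)^{p-1}$. *)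

theory Defs
  imports "HOL-Probability.Probability"
begin

text \<open>
  A random walk on the measurable space underlying \<open>M\<close>; only \<open>space M\<close> and
  \<open>sets M\<close> matter here. Membership in \<open>M \<rightarrow>\<^sub>M prob_algebra M\<close> says that every
  \<open>m x\<close> is a probability measure on the sigma-algebra of \<open>M\<close> and that
  \<open>x \<mapsto> m x B\<close> is measurable for every \<open>B\<close> in it.
\<close>

locale random_walk =
  fixes M :: "'a measure" and m :: "'a \<Rightarrow> 'a measure"
  assumes countably_generated:
      "\<exists>C. countable C \<and> C \<subseteq> Pow (space M) \<and> sets M = sigma_sets (space M) C"
    and kernel: "m \<in> M \<rightarrow>\<^sub>M prob_algebra M"

text \<open>
  The measure \<open>\<nu> \<otimes> m\<^sub>x\<close> on the product, i.e. \<open>d(\<nu> \<otimes> m\<^sub>x)(x, y) = dm\<^sub>x(y) d\<nu>(x)\<close>; see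
  \<open>emeasure_walk_measure\<close> below.
\<close>

definition walk_measure :: "'a measure \<Rightarrow> ('a \<Rightarrow> 'a measure) \<Rightarrow> ('a \<times> 'a) measure" where
  "walk_measure \<nu> m = \<nu> \<bind> (\<lambda>x. distr (m x) (\<nu> \<Otimes>\<^sub>M \<nu>) (Pair x))"

lemma emeasure_walk_measure:
  assumes "random_walk \<nu> m" and ne: "space \<nu> \<noteq> {}" and C: "C \<in> sets (\<nu> \<Otimes>\<^sub>M \<nu>)"
  shows "emeasure (walk_measure \<nu> m) C = (\<integral>\<^sup>+x. emeasure (m x) (Pair x -` C) \<partial>\<nu>)"
proof -
  have k: "m \<in> \<nu> \<rightarrow>\<^sub>M subprob_algebra \<nu>"
    using random_walk.kernel[OF assms(1)] by (rule measurable_prob_algebraD)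
  have "(\<lambda>x. distr (m x) (\<nu> \<Otimes>\<^sub>M \<nu>) (Pair x)) \<in> \<nu> \<rightarrow>\<^sub>M subprob_algebra (\<nu> \<Otimes>\<^sub>M \<nu>)"
    by (rule measurable_distr2[OF _ k]) simp
  then have "emeasure (walk_measure \<nu> m) C
      = (\<integral>\<^sup>+x. emeasure (distr (m x) (\<nu> \<Otimes>\<^sub>M \<nu>) (Pair x)) C \<partial>\<nu>)"
    unfolding walk_measure_def using ne C by (intro emeasure_bind) auto
  also have "\<dots> = (\<integral>\<^sup>+x. emeasure (m x) (Pair x -` C) \<partial>\<nu>)"
  proof (intro nn_integral_cong)
    fix x assume x: "x \<in> space \<nu>"
    have s: "sets (m x) = sets \<nu>"
      using measurable_space[OF k x] by (simp add: space_subprob_algebra)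
    have sp: "space (m x) = space \<nu>" using s by (rule sets_eq_imp_space_eq)
    have "Pair x -` C \<subseteq> space \<nu>"
      using sets.sets_into_space[OF C] by (auto simp: space_pair_measure)
    moreover have "Pair x \<in> m x \<rightarrow>\<^sub>M \<nu> \<Otimes>\<^sub>M \<nu>"
      using measurable_Pair1'[OF x, of \<nu>] s by (simp cong: measurable_cong_sets)
    ultimately show "emeasure (distr (m x) (\<nu> \<Otimes>\<^sub>M \<nu>) (Pair x)) C = emeasure (m x) (Pair x -` C)"
      using C sp by (simp add: emeasure_distr Int_absorb2)
  qed
  finally show ?thesis .
qed

locale reversible_random_walk_space =
  random_walk \<nu> m + sigma_finite_measure \<nu>
  for \<nu> :: "'a measure" and m :: "'a \<Rightarrow> 'a measure" +
  assumes reversible: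
    "distr (walk_measure \<nu> m) (\<nu> \<Otimes>\<^sub>M \<nu>) (\<lambda>(x, y). (y, x)) = walk_measure \<nu> m"

definition m_interaction :: "'a measure \<Rightarrow> ('a \<Rightarrow> 'a measure) \<Rightarrow> 'a set \<Rightarrow> 'a set \<Rightarrow> ennreal" where
  "m_interaction \<nu> m A B = (\<integral>\<^sup>+x\<in>A. emeasure (m x) B \<partial>\<nu>)"

definition m_boundary :: "'a measure \<Rightarrow> ('a \<Rightarrow> 'a measure) \<Rightarrow> 'a set \<Rightarrow> 'a set" where
  "m_boundary \<nu> m \<Omega> = {x \<in> space \<nu> - \<Omega>. emeasure (m x) \<Omega> > 0}"

definition m_closure :: "'a measure \<Rightarrow> ('a \<Rightarrow> 'a measure) \<Rightarrow> 'a set \<Rightarrow> 'a set" where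
  "m_closure \<nu> m \<Omega> = \<Omega> \<union> m_boundary \<nu> m \<Omega>"

definition m_connected :: "'a measure \<Rightarrow> ('a \<Rightarrow> 'a measure) \<Rightarrow> 'a set \<Rightarrow> bool" where
  "m_connected \<nu> m \<Omega> \<longleftrightarrow> \<Omega> \<in> sets \<nu> \<and> emeasure \<nu> \<Omega> > 0 \<and>
    (\<forall>A B. A \<in> sets \<nu> \<longrightarrow> B \<in> sets \<nu> \<longrightarrow> emeasure \<nu> A > 0 \<longrightarrow> emeasure \<nu> B > 0 \<longrightarrow>
      A \<union> B = \<Omega> \<longrightarrow> m_interaction \<nu> m A B > 0)"

text \<open>
  Elements of \<open>L\<^sup>p\<^sub>0(\<Omega>\<^sub>m, \<nu>)\<close> are represented by functions, not by classes modulo null sets.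
  The values outside \<open>\<Omega>\<^sub>m\<close> are irrelevant and unconstrained.
\<close>

definition Lp0 :: "'a measure \<Rightarrow> ('a \<Rightarrow> 'a measure) \<Rightarrow> real \<Rightarrow> 'a set \<Rightarrow> ('a \<Rightarrow> real) set" where
  "Lp0 \<nu> m p \<Omega> =
    {f. set_borel_measurable \<nu> (m_closure \<nu> m \<Omega>) f \<and>
        set_integrable \<nu> (m_closure \<nu> m \<Omega>) (\<lambda>x. \<bar>f x\<bar> powr p) \<and>
        (AE x in \<nu>. x \<in> m_boundary \<nu> m \<Omega> \<longrightarrow> f x = 0)}"

definition zero_on :: "'a measure \<Rightarrow> ('a \<Rightarrow> 'a measure) \<Rightarrow> 'a set \<Rightarrow> ('a \<Rightarrow> real) \<Rightarrow> bool" where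
  "zero_on \<nu> m \<Omega> f \<longleftrightarrow> (AE x in \<nu>. x \<in> m_closure \<nu> m \<Omega> \<longrightarrow> f x = 0)"

definition grad :: "('a \<Rightarrow> real) \<Rightarrow> 'a \<times> 'a \<Rightarrow> real" where
  "grad f = (\<lambda>(x, y). f y - f x)"

text \<open>
  For \<open>f\<close> in \<open>L\<^sup>p\<^sub>0\<close> the integrand below is integrable: both marginals of \<open>\<nu> \<otimes> m\<^sub>x\<close>
  are \<open>\<nu>\<close> by reversibility. So the Bochner integral never takes its default value \<open>0\<close>.
\<close>

definition grad_energy ::
    "'a measure \<Rightarrow> ('a \<Rightarrow> 'a measure) \<Rightarrow> real \<Rightarrow> 'a set \<Rightarrow> ('a \<Rightarrow> real) \<Rightarrow> real" where
  "grad_energy \<nu> m p \<Omega> f =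
    (LINT z : m_closure \<nu> m \<Omega> \<times> m_closure \<nu> m \<Omega> | walk_measure \<nu> m. \<bar>grad f z\<bar> powr p)"

definition poincare_inequality ::
    "'a measure \<Rightarrow> ('a \<Rightarrow> 'a measure) \<Rightarrow> real \<Rightarrow> 'a set \<Rightarrow> bool" where
  "poincare_inequality \<nu> m p \<Omega> \<longleftrightarrow>
    (\<exists>c>0. \<forall>f \<in> Lp0 \<nu> m p \<Omega>. c * (LINT x : \<Omega> | \<nu>. \<bar>f x\<bar> powr p) \<le> grad_energy \<nu> m p \<Omega> f)"

text \<open>
  The boundary condition is part of membership in \<open>L\<^sup>p\<^sub>0\<close>.
\<close>

definition is_torsional ::
    "'a measure \<Rightarrow> ('a \<Rightarrow> 'a measure) \<Rightarrow> real \<Rightarrow> 'a set \<Rightarrow> ('a \<Rightarrow> real) \<Rightarrow> bool" where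
  "is_torsional \<nu> m p \<Omega> f \<longleftrightarrow>
    f \<in> Lp0 \<nu> m p \<Omega> \<and>
    (AE x in \<nu>. x \<in> m_closure \<nu> m \<Omega> \<longrightarrow> 0 \<le> f x) \<and>
    (AE x in \<nu>. x \<in> \<Omega> \<longrightarrow>
      - (LINT y : m_closure \<nu> m \<Omega> | m x. \<bar>f y - f x\<bar> powr (p - 2) * (f y - f x)) = 1)"

text \<open>
  The solution is unique only up to \<open>\<nu>\<close>-null sets, so a representative is chosen.
\<close>

definition torsional_function ::
    "'a measure \<Rightarrow> ('a \<Rightarrow> 'a measure) \<Rightarrow> real \<Rightarrow> 'a set \<Rightarrow> 'a \<Rightarrow> real" where
  "torsional_function \<nu> m p \<Omega> = (SOME f. is_torsional \<nu> m p \<Omega> f)"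

definition torsional_rigidity ::
    "'a measure \<Rightarrow> ('a \<Rightarrow> 'a measure) \<Rightarrow> real \<Rightarrow> 'a set \<Rightarrow> real" where
  "torsional_rigidity \<nu> m p \<Omega> =
    (LINT x : \<Omega> | \<nu>. torsional_function \<nu> m p \<Omega> x) powr (p - 1)"

definition torsion_quotient ::
    "'a measure \<Rightarrow> ('a \<Rightarrow> 'a measure) \<Rightarrow> real \<Rightarrow> 'a set \<Rightarrow> ('a \<Rightarrow> real) \<Rightarrow> real" where
  "torsion_quotient \<nu> m p \<Omega> g =
    (LINT x : \<Omega> | \<nu>. \<bar>g x\<bar>) powr p / (1 / 2 * grad_energy \<nu> m p \<Omega> g)"

end

theory Submission
  imports Defs
begin

text \<open>
  The torsional function is a minimiser of \<open>J f = 1/(2p) \<integral>|\<nabla>f|\<^sup>p - \<integral>f\<close> over \<open>L\<^sup>p\<^sub>0\<close>, whose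
  Euler-Lagrange equation is the torsion equation tested against \<open>L\<^sup>p\<^sub>0\<close>, by reversibility. The
  Poincare inequality makes \<open>J\<close> coercive. A minimiser is obtained without weak compactness:
  \<open>J\<close> is submodular, so if \<open>J(f\<^sub>n) \<le> inf J + 2\<^sup>-\<^sup>n\<close> with \<open>f\<^sub>n \<ge> 0\<close>, then every finite maximum of
  \<open>f\<^sub>n, f\<^sub>n\<^sub>+\<^sub>1, \<dots>\<close> satisfies \<open>J \<le> inf J + 2 \<cdot> 2\<^sup>-\<^sup>n\<close>, and \<open>limsup f\<^sub>n\<close> is reached by two monotone
  limits, along which \<open>J\<close> is lower semicontinuous. For a torsional \<open>f\<close>, testing the equation with
  \<open>f\<close> gives \<open>\<integral>f = 1/2 \<integral>|\<nabla>f|\<^sup>p\<close>, and testing it with \<open>|g|\<close> and applying Hoelder's inequality gives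
  \<open>(\<integral>|g|)\<^sup>p \<le> (\<integral>f)\<^sup>p\<^sup>-\<^sup>1 \<cdot> 1/2 \<integral>|\<nabla>g|\<^sup>p\<close>.
\<close>

section \<open>Convexity inequalities for the power function |s|^p and its derivative\<close>

section \<open>The scalar p-flux\<close>

text \<open>For p > 1 this is the derivative of |s|^p / p. At s = 0 the factor s gives 0, also when
  p < 2 makes the exponent negative.\<close>

definition pflux :: "real \<Rightarrow> real \<Rightarrow> real" where
  "pflux p s = \<bar>s\<bar> powr (p - 2) * s"

lemma pflux_minus: "pflux p (- s) = - pflux p s"
  by (simp add: pflux_def)

lemma abs_pflux: "\<bar>pflux p s\<bar> = \<bar>s\<bar> powr (p - 1)"
proof (cases "s = 0")
  case False
  have "\<bar>s\<bar> powr (p - 1) = \<bar>s\<bar> powr (p - 2 + 1)" by simp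
  also have "\<dots> = \<bar>s\<bar> powr (p - 2) * \<bar>s\<bar>"
    using False by (subst powr_add) simp
  finally show ?thesis by (simp add: pflux_def abs_mult)
qed (simp add: pflux_def)

lemma pflux_mult_self: "pflux p s * s = \<bar>s\<bar> powr p"
proof (cases "s = 0")
  case False
  have "\<bar>s\<bar> powr p = \<bar>s\<bar> powr (p - 2 + 2)" by simp
  also have "\<dots> = \<bar>s\<bar> powr (p - 2) * (s * s)"
    using False by (subst powr_add) (simp add: power2_eq_square)
  finally show ?thesis by (simp add: pflux_def)
qed (simp add: pflux_def)

lemma borel_measurable_pflux [measurable]: "pflux p \<in> borel_measurable borel"
  unfolding pflux_def by measurable

text \<open>Young's inequality with the conjugate exponents p and q = p / (p - 1): the flux has
  modulus |a|^(p-1), whose q-th power is |a|^p. It serves both the integrability of products and the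
  bound on the quotient.\<close>

lemma pflux_Young:
  assumes "1 < p"
  shows "\<bar>pflux p a * b\<bar> \<le> (1 - 1 / p) * \<bar>a\<bar> powr p + \<bar>b\<bar> powr p / p"
proof -
  define q where "q = p / (p - 1)"
  have q: "1 < q" "1 / p + 1 / q = 1" "1 / q = 1 - 1 / p" "(p - 1) * q = p"
    using assms by (auto simp: q_def field_simps)
  have "\<bar>b\<bar> * \<bar>a\<bar> powr (p - 1) \<le> \<bar>b\<bar> powr p / p + (\<bar>a\<bar> powr (p - 1)) powr q / q"
    using assms q by (intro Youngs_inequality) auto
  also have "(\<bar>a\<bar> powr (p - 1)) powr q / q = 1 / q * \<bar>a\<bar> powr p"
    using q(4) by (simp add: powr_powr)
  also have "1 / q = 1 - 1 / p" by (fact q(3))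
  finally show ?thesis by (simp add: abs_mult abs_pflux mult.commute)
qed

text \<open>Convexity of |s|^p, with slope p * \<open>pflux p a\<close> at a. Young's inequality
  yields it without differentiating.\<close>

lemma abs_powr_tangent:
  fixes a b :: real
  assumes "1 < p"
  shows "\<bar>a\<bar> powr p + p * (pflux p a * (b - a)) \<le> \<bar>b\<bar> powr p"
proof -
  have "pflux p a * b \<le> (1 - 1 / p) * \<bar>a\<bar> powr p + \<bar>b\<bar> powr p / p"
    using pflux_Young[OF assms, of a b] by linarith
  then have "p * (pflux p a * b) \<le> p * ((1 - 1 / p) * \<bar>a\<bar> powr p + \<bar>b\<bar> powr p / p)"
    using assms by (intro mult_left_mono) auto
  also have "\<dots> = (p - 1) * \<bar>a\<bar> powr p + \<bar>b\<bar> powr p"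
    using assms by (simp add: field_simps)
  finally have "p * (pflux p a * b) \<le> (p - 1) * \<bar>a\<bar> powr p + \<bar>b\<bar> powr p" .
  moreover have "pflux p a * (b - a) = pflux p a * b - \<bar>a\<bar> powr p"
    by (simp add: right_diff_distrib pflux_mult_self)
  ultimately show ?thesis by (simp add: left_diff_distrib right_diff_distrib)
qed

lemma pflux_mono:
  assumes "1 < p" "a \<le> b"
  shows "pflux p a \<le> pflux p b"
proof (rule ccontr)
  assume less: "\<not> pflux p a \<le> pflux p b"
  then have "a < b" using assms(2) by (cases "a = b") auto
  have "p * ((pflux p a - pflux p b) * (b - a)) \<le> 0"
    using abs_powr_tangent[OF assms(1), of a b] abs_powr_tangent[OF assms(1), of b a]
    by (simp add: algebra_simps)
  moreover have "0 < p * ((pflux p a - pflux p b) * (b - a))"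
    using less \<open>a < b\<close> assms by (intro mult_pos_pos) auto
  ultimately show False by simp
qed

text \<open>By symmetry let u \<le> v. Moving u down to X and v up to Y changes both by the same
  amount u - X, and the slope at v is at least the slope at u.\<close>

lemma abs_powr_spread:
  fixes a b X Y :: real
  assumes "1 < p" "X \<le> u" "X \<le> v" "u + v = X + Y"
  shows "\<bar>u\<bar> powr p + \<bar>v\<bar> powr p \<le> \<bar>X\<bar> powr p + \<bar>Y\<bar> powr p"
  using assms(2-)
proof (induction u v rule: linorder_wlog)
  case (le u v)
  have "0 \<le> p * ((pflux p v - pflux p u) * (u - X))"
    using le assms(1) by (intro mult_nonneg_nonneg) (auto intro: pflux_mono)
  then have "0 \<le> p * (pflux p v * (u - X)) + p * (pflux p u * (X - u))"
    by (simp add: algebra_simps)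
  moreover have "Y - v = u - X" using le by simp
  ultimately show ?case
    using abs_powr_tangent[OF assms(1), of u X] abs_powr_tangent[OF assms(1), of v Y]
    by simp
qed (auto simp: add.commute)

text \<open>Pointwise source of submodularity. If the pairs a, b and c, d are ordered alike, the two
  sides agree; otherwise the differences on the left lie between those on the right and have the
  same sum.\<close>

lemma abs_powr_diff_max_min:
  fixes a b c d :: real
  assumes "1 < p"
  shows "\<bar>max a b - max c d\<bar> powr p + \<bar>min a b - min c d\<bar> powr p
    \<le> \<bar>a - c\<bar> powr p + \<bar>b - d\<bar> powr p"
proof -
  have "a \<ge> b \<and> c \<ge> d \<or> a \<le> b \<and> c \<le> d \<or> a \<ge> b \<and> c \<le> d \<or> a \<le> b \<and> c \<ge> d" by linarith
  then show ?thesis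
    using abs_powr_spread[OF assms, of "b - d" "a - d" "b - c" "a - c"]
      abs_powr_spread[OF assms, of "a - c" "b - c" "a - d" "b - d"]
    by (auto simp: max_def min_def add.commute)
qed

lemma abs_powr_add_le:
  fixes a b :: real
  assumes "1 < p"
  shows "\<bar>a + b\<bar> powr p \<le> 2 powr p * (\<bar>a\<bar> powr p + \<bar>b\<bar> powr p)"
proof -
  have "\<bar>a + b\<bar> powr p \<le> (2 * max \<bar>a\<bar> \<bar>b\<bar>) powr p"
    using assms by (intro powr_mono2) auto
  also have "\<dots> = 2 powr p * max \<bar>a\<bar> \<bar>b\<bar> powr p"
    by (simp add: powr_mult)
  also have "max \<bar>a\<bar> \<bar>b\<bar> powr p \<le> \<bar>a\<bar> powr p + \<bar>b\<bar> powr p"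
    by (simp add: max_def)
  finally show ?thesis by (simp add: mult_left_mono)
qed

text \<open>Above the level K, s = s^(1-p) s^p \<le> K^(1-p) s^p because 1 - p < 0. In an L^p
  bounded family this makes the tails uniformly small.\<close>

lemma le_truncation:
  fixes s K :: real
  assumes "1 < p" "0 < K" "0 \<le> s"
  shows "s \<le> min s K + K powr (1 - p) * s powr p"
proof (cases "s \<le> K")
  case False
  have "s = s powr (1 - p) * s powr p"
    using False assms by (simp add: powr_add[symmetric])
  also have "\<dots> \<le> K powr (1 - p) * s powr p"
    using False assms by (intro mult_right_mono powr_mono2') auto
  finally show ?thesis using assms False by linarith
qed simp

lemma isCont_pflux:
  assumes "1 < p"
  shows "isCont (pflux p) a"
proof (cases "a = 0")
  case True
  \<comment> \<open>The exponent p - 2 may be negative, so continuity at 0 is read off from the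
    modulus |s|^(p-1), whose exponent is positive.\<close>
  have "((\<lambda>s. \<bar>s\<bar> powr (p - 1)) \<longlongrightarrow> \<bar>0\<bar> powr (p - 1)) (at (0::real))"
    using assms by (intro tendsto_powr' tendsto_intros) auto
  then have "((\<lambda>s. \<bar>pflux p s\<bar>) \<longlongrightarrow> 0) (at 0)"
    by (simp add: abs_pflux)
  then have "(pflux p \<longlongrightarrow> 0) (at 0)"
    by (simp add: tendsto_rabs_zero_iff)
  then show ?thesis using True by (simp add: isCont_def pflux_def)
next
  case False
  then show ?thesis
    unfolding pflux_def by (intro continuous_intros) auto
qed

section \<open>Function space, finite energy and lattice structure for a symmetric measure on
  pairs\<close>

section \<open>Energies of symmetric measures\<close>

text \<open>Functions vanishing everywhere off \<Omega> replace the almost-everywhere boundary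
  condition, so lattice operations can be done pointwise without null sets.\<close>

definition supported_Lp :: "'a measure \<Rightarrow> real \<Rightarrow> 'a set \<Rightarrow> ('a \<Rightarrow> real) set" where
  "supported_Lp \<nu> p \<Omega> =
    {f \<in> borel_measurable \<nu>. (\<forall>x. x \<notin> \<Omega> \<longrightarrow> f x = 0) \<and> integrable \<nu> (\<lambda>x. \<bar>f x\<bar> powr p)}"

definition energy :: "('a \<times> 'a) measure \<Rightarrow> real \<Rightarrow> ('a \<Rightarrow> real) \<Rightarrow> real" where
  "energy Q p f = (LINT z|Q. \<bar>grad f z\<bar> powr p)"

lemma borel_measurable_grad [measurable]:
  assumes [measurable]: "f \<in> borel_measurable \<nu>"
  shows "grad f \<in> borel_measurable (\<nu> \<Otimes>\<^sub>M \<nu>)"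
  unfolding grad_def by measurable

lemma grad_add_scale: "grad (\<lambda>x. f x + t * g x) z = grad f z + t * grad g z"
  by (simp add: grad_def case_prod_beta algebra_simps)

text \<open>Fatou's lemma for p-th powers, with integrability of the limit as part of the
  result.\<close>

lemma integral_abs_powr_le_of_AE_tendsto:
  fixes u :: "nat \<Rightarrow> 'a \<Rightarrow> real"
  assumes [measurable]: "\<And>k. u k \<in> borel_measurable M" "v \<in> borel_measurable M"
    and "1 < p"
    and int: "\<And>k. integrable M (\<lambda>x. \<bar>u k x\<bar> powr p)"
    and le: "\<And>k. (LINT x|M. \<bar>u k x\<bar> powr p) \<le> b k"
    and b: "b \<longlonglongrightarrow> B"
    and lim: "AE x in M. (\<lambda>k. u k x) \<longlonglongrightarrow> v x"
  shows "integrable M (\<lambda>x. \<bar>v x\<bar> powr p)" "(LINT x|M. \<bar>v x\<bar> powr p) \<le> B"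
proof -
  \<comment> \<open>\<open>ennreal\<close> sends negative numbers to 0, so the final bound can be
    read back in the reals only once \<open>B\<close> is known to be nonnegative.\<close>
  have nonneg: "0 \<le> b k" for k
    using le[of k] by (rule order_trans[rotated]) (simp add: integral_nonneg_AE)
  then have B: "0 \<le> B" using b by (intro LIMSEQ_le_const) auto
  have "(\<integral>\<^sup>+x. ennreal (\<bar>v x\<bar> powr p) \<partial>M)
      = (\<integral>\<^sup>+x. liminf (\<lambda>k. ennreal (\<bar>u k x\<bar> powr p)) \<partial>M)"
    using lim
  proof (intro nn_integral_cong_AE, eventually_elim)
    case (elim x)
    have "(\<lambda>k. \<bar>u k x\<bar> powr p) \<longlonglongrightarrow> \<bar>v x\<bar> powr p"
      using \<open>1 < p\<close> elim by (intro tendsto_powr' tendsto_intros) auto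
    then have "(\<lambda>k. ennreal (\<bar>u k x\<bar> powr p)) \<longlonglongrightarrow> ennreal (\<bar>v x\<bar> powr p)"
      by (rule tendsto_ennrealI)
    then show ?case by (intro lim_imp_Liminf[symmetric]) auto
  qed
  also have "\<dots> \<le> liminf (\<lambda>k. \<integral>\<^sup>+x. ennreal (\<bar>u k x\<bar> powr p) \<partial>M)"
    by (intro nn_integral_liminf) measurable
  also have "\<dots> \<le> liminf (\<lambda>k. ennreal (b k))"
    using le by (intro Liminf_mono always_eventually allI)
      (simp add: nn_integral_eq_integral[OF int] ennreal_leI)
  also have "\<dots> = ennreal B"
    using b by (intro lim_imp_Liminf tendsto_ennrealI) auto
  finally have fin: "(\<integral>\<^sup>+x. ennreal (\<bar>v x\<bar> powr p) \<partial>M) \<le> ennreal B" .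
  then show I: "integrable M (\<lambda>x. \<bar>v x\<bar> powr p)"
    by (intro integrableI_bounded) (auto simp: le_less_trans)
  show "(LINT x|M. \<bar>v x\<bar> powr p) \<le> B"
    using fin B by (simp add: nn_integral_eq_integral[OF I])
qed

text \<open>\<open>Q\<close> abstracts the walk measure restricted to pairs in the closure of
  \<Omega>. Its marginal is only bounded by \<nu>, since the restriction may discard mass.\<close>

locale nonlocal_energy =
  fixes \<nu> :: "'a measure" and Q :: "('a \<times> 'a) measure" and \<Omega> :: "'a set" and p :: real
  assumes p_gt_1: "1 < p"
    and sets_Omega [measurable]: "\<Omega> \<in> sets \<nu>"
    and finite_Omega: "emeasure \<nu> \<Omega> < \<infinity>"
    and sets_Q [measurable_cong]: "sets Q = sets (\<nu> \<Otimes>\<^sub>M \<nu>)"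
    and swap_Q: "distr Q (\<nu> \<Otimes>\<^sub>M \<nu>) (\<lambda>(x, y). (y, x)) = Q"
    and marginal_Q: "\<And>h. h \<in> borel_measurable \<nu> \<Longrightarrow> (\<integral>\<^sup>+z. h (fst z) \<partial>Q) \<le> (\<integral>\<^sup>+x. h x \<partial>\<nu>)"
begin

abbreviation "V \<equiv> supported_Lp \<nu> p \<Omega>"

abbreviation "En \<equiv> energy Q p"

text \<open>Differentiating the p-th power produces p, and \<open>Q\<close> counts each pair in both
  orders; 1 / (2 p) compensates for both in the Euler-Lagrange equation.\<close>

definition J :: "('a \<Rightarrow> real) \<Rightarrow> real" where
  "J f = En f / (2 * p) - (LINT x|\<nu>. f x)"

lemma V_measurable [measurable_dest]: "f \<in> V \<Longrightarrow> f \<in> borel_measurable \<nu>"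
  by (simp add: supported_Lp_def)

lemma V_zero: "f \<in> V \<Longrightarrow> x \<notin> \<Omega> \<Longrightarrow> f x = 0"
  by (simp add: supported_Lp_def)

lemma V_integrable_powr: "f \<in> V \<Longrightarrow> integrable \<nu> (\<lambda>x. \<bar>f x\<bar> powr p)"
  by (simp add: supported_Lp_def)

lemma borel_measurable_grad_Q [measurable]:
  "f \<in> borel_measurable \<nu> \<Longrightarrow> grad f \<in> borel_measurable Q"
  using borel_measurable_grad measurable_cong_sets[OF sets_Q refl] by blast

lemma nn_integral_swap:
  assumes "h \<in> borel_measurable (\<nu> \<Otimes>\<^sub>M \<nu>)"
  shows "(\<integral>\<^sup>+z. h (snd z, fst z) \<partial>Q) = (\<integral>\<^sup>+z. h z \<partial>Q)"
proof -
  have "(\<integral>\<^sup>+z. h z \<partial>Q) = (\<integral>\<^sup>+z. h z \<partial>distr Q (\<nu> \<Otimes>\<^sub>M \<nu>) (\<lambda>(x, y). (y, x)))"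
    by (simp add: swap_Q)
  also have "\<dots> = (\<integral>\<^sup>+z. h (snd z, fst z) \<partial>Q)"
    using assms by (subst nn_integral_distr) (auto simp: case_prod_beta)
  finally show ?thesis by simp
qed

lemma integral_swap:
  fixes h :: "'a \<times> 'a \<Rightarrow> real"
  assumes "h \<in> borel_measurable (\<nu> \<Otimes>\<^sub>M \<nu>)"
  shows "(LINT z|Q. h (snd z, fst z)) = (LINT z|Q. h z)"
proof -
  have "(LINT z|Q. h z) = (LINT z|distr Q (\<nu> \<Otimes>\<^sub>M \<nu>) (\<lambda>(x, y). (y, x)). h z)"
    by (simp add: swap_Q)
  also have "\<dots> = (LINT z|Q. h (snd z, fst z))"
    using assms by (subst integral_distr) (auto simp: case_prod_beta)
  finally show ?thesis by simp
qed

lemma marginal_Q_snd: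
  assumes [measurable]: "h \<in> borel_measurable \<nu>"
  shows "(\<integral>\<^sup>+z. h (snd z) \<partial>Q) \<le> (\<integral>\<^sup>+x. h x \<partial>\<nu>)"
  using nn_integral_swap[of "\<lambda>z. h (fst z)"] marginal_Q[of h] by simp

text \<open>By the marginal bounds, both strips over a \<nu>-null set are \<open>Q\<close>-null.
  This carries almost-everywhere convergence and equality from points to pairs.\<close>

lemma AE_Q_marginals:
  assumes "AE x in \<nu>. P x"
  shows "AE z in Q. P (fst z) \<and> P (snd z)"
proof -
  obtain N where N: "N \<in> null_sets \<nu>" "{x \<in> space \<nu>. \<not> P x} \<subseteq> N"
    using assms by (auto simp: eventually_ae_filter)
  then have [measurable]: "N \<in> sets \<nu>" by auto
  have "(\<integral>\<^sup>+z. indicator N (fst z) \<partial>Q) = 0" "(\<integral>\<^sup>+z. indicator N (snd z) \<partial>Q) = 0"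
    using marginal_Q[of "indicator N"] marginal_Q_snd[of "indicator N"] N(1) by auto
  then have "AE z in Q. fst z \<notin> N" "AE z in Q. snd z \<notin> N"
    by (auto simp: nn_integral_0_iff_AE indicator_def)
  moreover have "AE z in Q. z \<in> space \<nu> \<times> space \<nu>"
    using AE_space[of Q] sets_eq_imp_space_eq[OF sets_Q] by (simp add: space_pair_measure)
  ultimately show ?thesis
    by eventually_elim (use N(2) in auto)
qed

lemma integrable_marginals:
  fixes h :: "'a \<Rightarrow> real"
  assumes "integrable \<nu> h"
  shows "integrable Q (\<lambda>z. h (fst z))" "integrable Q (\<lambda>z. h (snd z))"
proof -
  have [measurable]: "h \<in> borel_measurable \<nu>" using assms by auto
  have "(\<integral>\<^sup>+x. ennreal (norm (h x)) \<partial>\<nu>) < \<infinity>"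
    using assms by (simp add: integrable_iff_bounded)
  then show "integrable Q (\<lambda>z. h (fst z))" "integrable Q (\<lambda>z. h (snd z))"
    using marginal_Q[of "\<lambda>x. ennreal (norm (h x))"] marginal_Q_snd[of "\<lambda>x. ennreal (norm (h x))"]
    by (auto intro!: integrableI_bounded intro: le_less_trans)
qed

text \<open>|f(y) - f(x)|^p is bounded by 2^p (|f(y)|^p + |f(x)|^p), and both marginals of
  \<open>Q\<close> are dominated by \<nu>.\<close>

lemma integrable_grad_powr:
  assumes "f \<in> V"
  shows "integrable Q (\<lambda>z. \<bar>grad f z\<bar> powr p)"
proof (rule Bochner_Integration.integrable_bound)
  have [measurable]: "f \<in> borel_measurable \<nu>" using assms by (rule V_measurable)
  show "integrable Q (\<lambda>z. 2 powr p * (\<bar>f (snd z)\<bar> powr p + \<bar>f (fst z)\<bar> powr p))"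
    using integrable_marginals[OF V_integrable_powr[OF assms]] by auto
  show "(\<lambda>z. \<bar>grad f z\<bar> powr p) \<in> borel_measurable Q" by measurable
  have "\<bar>grad f z\<bar> powr p \<le> 2 powr p * (\<bar>f (snd z)\<bar> powr p + \<bar>f (fst z)\<bar> powr p)" for z
    using abs_powr_add_le[OF p_gt_1, of "f (snd z)" "- f (fst z)"]
    by (simp add: grad_def case_prod_beta)
  then show "AE z in Q. norm (\<bar>grad f z\<bar> powr p)
      \<le> norm (2 powr p * (\<bar>f (snd z)\<bar> powr p + \<bar>f (fst z)\<bar> powr p))"
    by simp
qed

lemma integrable_pflux_mult:
  fixes a b :: "'b \<Rightarrow> real"
  assumes [measurable]: "a \<in> borel_measurable M" "b \<in> borel_measurable M"
    and "integrable M (\<lambda>z. \<bar>a z\<bar> powr p)" "integrable M (\<lambda>z. \<bar>b z\<bar> powr p)"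
  shows "integrable M (\<lambda>z. pflux p (a z) * b z)"
proof (rule Bochner_Integration.integrable_bound)
  show "integrable M (\<lambda>z. (1 - 1 / p) * \<bar>a z\<bar> powr p + \<bar>b z\<bar> powr p / p)"
    using assms by auto
  show "AE z in M. norm (pflux p (a z) * b z)
      \<le> norm ((1 - 1 / p) * \<bar>a z\<bar> powr p + \<bar>b z\<bar> powr p / p)"
    using pflux_Young[OF p_gt_1] by (auto intro!: AE_I2 order_trans[OF _ abs_ge_self])
qed measurable

lemma integrable_pflux_grad:
  assumes "f \<in> V" "g \<in> V"
  shows "integrable Q (\<lambda>z. pflux p (grad f z) * grad g z)"
  using assms by (intro integrable_pflux_mult integrable_grad_powr borel_measurable_grad_Q V_measurable)

lemma V_dominated:
  assumes "f \<in> V" "g \<in> V" "h \<in> borel_measurable \<nu>"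
    and le: "\<And>x. \<bar>h x\<bar> \<le> \<bar>f x\<bar> + \<bar>g x\<bar>"
  shows "h \<in> V"
proof -
  have "h x = 0" if "x \<notin> \<Omega>" for x
    using le[of x] that assms by (simp add: V_zero)
  moreover have "integrable \<nu> (\<lambda>x. \<bar>h x\<bar> powr p)"
  proof (rule Bochner_Integration.integrable_bound)
    show "integrable \<nu> (\<lambda>x. 2 powr p * (\<bar>f x\<bar> powr p + \<bar>g x\<bar> powr p))"
      using assms by (auto intro!: V_integrable_powr)
    have "\<bar>h x\<bar> powr p \<le> 2 powr p * (\<bar>f x\<bar> powr p + \<bar>g x\<bar> powr p)" for x
    proof -
      have "\<bar>h x\<bar> powr p \<le> \<bar>\<bar>f x\<bar> + \<bar>g x\<bar>\<bar> powr p"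
        using le[of x] p_gt_1 by (intro powr_mono2) auto
      also have "\<dots> \<le> 2 powr p * (\<bar>f x\<bar> powr p + \<bar>g x\<bar> powr p)"
        using abs_powr_add_le[OF p_gt_1, of "\<bar>f x\<bar>" "\<bar>g x\<bar>"] by simp
      finally show ?thesis .
    qed
    then show "AE x in \<nu>. norm (\<bar>h x\<bar> powr p)
        \<le> norm (2 powr p * (\<bar>f x\<bar> powr p + \<bar>g x\<bar> powr p))"
      by simp
  qed (use assms(3) in measurable)
  ultimately show ?thesis using assms by (simp add: supported_Lp_def)
qed

lemma V_scale: "f \<in> V \<Longrightarrow> (\<lambda>x. t * f x) \<in> V"
  by (auto simp: supported_Lp_def abs_mult powr_mult)

lemma V_add: "f \<in> V \<Longrightarrow> g \<in> V \<Longrightarrow> (\<lambda>x. f x + g x) \<in> V"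
  by (rule V_dominated[of f g]) (auto intro: borel_measurable_add V_measurable)

lemma V_abs: "f \<in> V \<Longrightarrow> (\<lambda>x. \<bar>f x\<bar>) \<in> V"
  by (rule V_dominated[of f f]) (auto intro: borel_measurable_abs V_measurable)

lemma V_max: "f \<in> V \<Longrightarrow> g \<in> V \<Longrightarrow> (\<lambda>x. max (f x) (g x)) \<in> V"
  by (rule V_dominated[of f g]) (auto intro: borel_measurable_max V_measurable)

lemma V_min: "f \<in> V \<Longrightarrow> g \<in> V \<Longrightarrow> (\<lambda>x. min (f x) (g x)) \<in> V"
  by (rule V_dominated[of f g]) (auto intro: borel_measurable_min V_measurable)

lemma V_indicator:
  assumes [measurable]: "A \<in> sets \<nu>" and "A \<subseteq> \<Omega>"
  shows "indicator A \<in> V"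
proof -
  have "emeasure \<nu> A < \<infinity>"
    using emeasure_mono[OF assms(2) sets_Omega] finite_Omega by (rule le_less_trans)
  then have "integrable \<nu> (indicator A :: 'a \<Rightarrow> real)" by simp
  moreover have "(\<lambda>x. \<bar>indicator A x\<bar> powr p) = (indicator A :: 'a \<Rightarrow> real)"
    by (auto simp: indicator_def)
  ultimately show ?thesis
    using assms(2) by (auto simp: supported_Lp_def indicator_def)
qed

text \<open>Truncation at level 1 gives |f| \<le> 1 + |f|^p on \<Omega>, which has finite
  measure.\<close>

lemma V_integrable:
  assumes "f \<in> V"
  shows "integrable \<nu> f"
proof (rule Bochner_Integration.integrable_bound)
  have "integrable \<nu> (indicator \<Omega> :: 'a \<Rightarrow> real)" using finite_Omega by simp
  then show "integrable \<nu> (\<lambda>x. indicator \<Omega> x + \<bar>f x\<bar> powr p)"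
    using V_integrable_powr[OF assms] by auto
  have "\<bar>f x\<bar> \<le> indicator \<Omega> x + \<bar>f x\<bar> powr p" for x
    using le_truncation[OF p_gt_1, of 1 "\<bar>f x\<bar>"] V_zero[OF assms, of x]
    by (auto simp: indicator_def)
  then show "AE x in \<nu>. norm (f x) \<le> norm (indicator \<Omega> x + \<bar>f x\<bar> powr p)"
    by (intro AE_I2) (simp add: order_trans[OF _ abs_ge_self])
qed (use assms in measurable)

lemma V_integrable_min: "f \<in> V \<Longrightarrow> integrable \<nu> (\<lambda>x. min (f x) (K * indicator \<Omega> x))"
  using finite_Omega by (intro integrable_min) (simp_all add: V_integrable)

lemma integral_truncation_le:
  assumes f: "f \<in> V" and nonneg: "\<And>x. 0 \<le> f x" and "0 < K"
  shows "(LINT x|\<nu>. f x) \<le>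
    (LINT x|\<nu>. min (f x) (K * indicator \<Omega> x)) + K powr (1 - p) * (LINT x|\<nu>. \<bar>f x\<bar> powr p)"
proof -
  have "(LINT x|\<nu>. f x) \<le>
      (LINT x|\<nu>. min (f x) (K * indicator \<Omega> x) + K powr (1 - p) * \<bar>f x\<bar> powr p)"
  proof (rule integral_mono)
    show "f x \<le> min (f x) (K * indicator \<Omega> x) + K powr (1 - p) * \<bar>f x\<bar> powr p" for x
      using le_truncation[OF p_gt_1 \<open>0 < K\<close>, of "f x"] nonneg[of x] V_zero[OF f, of x]
      by (auto simp: indicator_def)
  qed (simp_all add: f V_integrable V_integrable_min V_integrable_powr)
  also have "\<dots> = (LINT x|\<nu>. min (f x) (K * indicator \<Omega> x))
      + K powr (1 - p) * (LINT x|\<nu>. \<bar>f x\<bar> powr p)"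
    by (simp add: f V_integrable_min V_integrable_powr)
  finally show ?thesis .
qed

text \<open>Absolute values shrink every difference and raise the integral, so minimising sequences
  may be taken nonnegative.\<close>

lemma J_abs_le:
  assumes f: "f \<in> V"
  shows "J (\<lambda>x. \<bar>f x\<bar>) \<le> J f"
proof -
  have "En (\<lambda>x. \<bar>f x\<bar>) \<le> En f"
    unfolding energy_def
  proof (rule integral_mono)
    show "\<bar>grad (\<lambda>x. \<bar>f x\<bar>) z\<bar> powr p \<le> \<bar>grad f z\<bar> powr p" for z
      using p_gt_1 by (intro powr_mono2) (auto simp: grad_def case_prod_beta)
  qed (use f in \<open>auto intro!: integrable_grad_powr V_abs\<close>)
  then have "En (\<lambda>x. \<bar>f x\<bar>) / (2 * p) \<le> En f / (2 * p)"
    using p_gt_1 by (simp add: divide_right_mono)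
  moreover have "(LINT x|\<nu>. f x) \<le> (LINT x|\<nu>. \<bar>f x\<bar>)"
    using f by (intro integral_mono V_integrable V_abs) auto
  ultimately show ?thesis by (simp add: J_def)
qed

text \<open>The energies inherit the pointwise max-min inequality, and the linear term is preserved
  exactly because max + min = f + g.\<close>

lemma J_submodular:
  assumes f: "f \<in> V" and g: "g \<in> V"
  shows "J (\<lambda>x. max (f x) (g x)) + J (\<lambda>x. min (f x) (g x)) \<le> J f + J g"
proof -
  have "En (\<lambda>x. max (f x) (g x)) + En (\<lambda>x. min (f x) (g x))
      = (LINT z|Q. \<bar>grad (\<lambda>x. max (f x) (g x)) z\<bar> powr p + \<bar>grad (\<lambda>x. min (f x) (g x)) z\<bar> powr p)"
    unfolding energy_def using f g
    by (intro Bochner_Integration.integral_add[symmetric] integrable_grad_powr V_max V_min)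
  also have "\<dots> \<le> (LINT z|Q. \<bar>grad f z\<bar> powr p + \<bar>grad g z\<bar> powr p)"
  proof (rule integral_mono)
    show "\<bar>grad (\<lambda>x. max (f x) (g x)) z\<bar> powr p + \<bar>grad (\<lambda>x. min (f x) (g x)) z\<bar> powr p
        \<le> \<bar>grad f z\<bar> powr p + \<bar>grad g z\<bar> powr p" for z
      using abs_powr_diff_max_min[OF p_gt_1] by (simp add: grad_def case_prod_beta)
  qed (use f g in \<open>auto intro!: Bochner_Integration.integrable_add integrable_grad_powr V_max V_min\<close>)
  also have "\<dots> = En f + En g"
    unfolding energy_def using f g
    by (intro Bochner_Integration.integral_add integrable_grad_powr)
  finally have "(En (\<lambda>x. max (f x) (g x)) + En (\<lambda>x. min (f x) (g x))) / (2 * p)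
      \<le> (En f + En g) / (2 * p)"
    using p_gt_1 by (simp add: divide_right_mono)
  moreover have "(LINT x|\<nu>. max (f x) (g x)) + (LINT x|\<nu>. min (f x) (g x))
      = (LINT x|\<nu>. f x) + (LINT x|\<nu>. g x)"
  proof -
    have "(LINT x|\<nu>. max (f x) (g x)) + (LINT x|\<nu>. min (f x) (g x))
        = (LINT x|\<nu>. max (f x) (g x) + min (f x) (g x))"
      using f g by (intro Bochner_Integration.integral_add[symmetric] V_integrable V_max V_min)
    also have "\<dots> = (LINT x|\<nu>. f x + g x)"
      by (intro Bochner_Integration.integral_cong) auto
    also have "\<dots> = (LINT x|\<nu>. f x) + (LINT x|\<nu>. g x)"
      using f g by (intro Bochner_Integration.integral_add V_integrable)
    finally show ?thesis .
  qed
  ultimately show ?thesis by (simp add: J_def add_divide_distrib)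
qed

end

section \<open>Minimisation of \<open>J\<close> by monotone limits of finite maxima\<close>

section \<open>Existence of a minimiser\<close>

text \<open>The error vanishes as K tends to infinity because 1 - p < 0. This removes a truncation
  level at the end of an argument.\<close>

lemma le_if_le_add_powr:
  fixes x y b p :: real
  assumes "1 < p" and le: "\<And>K. 0 < K \<Longrightarrow> x \<le> y + K powr (1 - p) * b"
  shows "x \<le> y"
proof -
  have "((\<lambda>K. K powr (1 - p)) \<longlongrightarrow> 0) at_top"
    using \<open>1 < p\<close> by (intro tendsto_neg_powr filterlim_ident) auto
  then have "((\<lambda>K. y + K powr (1 - p) * b) \<longlongrightarrow> y + 0 * b) at_top"
    by (intro tendsto_intros)
  moreover have "\<forall>\<^sub>F K in at_top. x \<le> y + K powr (1 - p) * b"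
    using eventually_gt_at_top[of 0] by eventually_elim (rule le)
  ultimately show ?thesis
    by (intro tendsto_lowerbound[of "\<lambda>K. y + K powr (1 - p) * b" y at_top]) auto
qed

text \<open>The maximum of f_n, ..., f_(n+k). Peeling off the first function leaves a tail starting
  at n + 1, where the induction hypothesis has a smaller error.\<close>

primrec upper_envelope :: "(nat \<Rightarrow> 'a \<Rightarrow> real) \<Rightarrow> nat \<Rightarrow> nat \<Rightarrow> 'a \<Rightarrow> real" where
  "upper_envelope f 0 n = f n"
| "upper_envelope f (Suc k) n = (\<lambda>x. max (f n x) (upper_envelope f k (Suc n) x))"

lemma upper_envelope_Suc_le: "upper_envelope f k n x \<le> upper_envelope f (Suc k) n x"
  by (induction k arbitrary: n) (auto simp: max.coboundedI2 intro: max.mono)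

locale coercive_nonlocal_energy = nonlocal_energy +
  fixes c :: real
  assumes c_pos: "0 < c"
    and coercive: "\<And>f. f \<in> supported_Lp \<nu> p \<Omega> \<Longrightarrow> c * (LINT x|\<nu>. \<bar>f x\<bar> powr p) \<le> energy Q p f"
begin

lemma energy_nonneg: "0 \<le> En f"
  by (simp add: energy_def integral_nonneg_AE)

text \<open>The linear term is absorbed: below the level K it is at most K times the measure of
  \<Omega>, and the tail is controlled by the Poincare inequality.\<close>

lemma J_coercive:
  obtains C where "\<And>f. f \<in> V \<Longrightarrow> En f / (4 * p) - C \<le> J f"
proof
  \<comment> \<open>Makes K^(1-p) = c / (4 p), so that the tail costs half of the energy term in
    \<open>J\<close>.\<close>
  define K where "K = (c / (4 * p)) powr (1 / (1 - p))"
  have K: "0 < K" "K powr (1 - p) = c / (4 * p)"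
    using c_pos p_gt_1 by (auto simp: K_def powr_powr)
  fix f assume f: "f \<in> V"
  have int: "(LINT x|\<nu>. K * indicator \<Omega> x) = K * measure \<nu> \<Omega>"
    using finite_Omega by simp
  have "(LINT x|\<nu>. f x) \<le> (LINT x|\<nu>. \<bar>f x\<bar>)"
    by (intro integral_mono) (simp_all add: f V_integrable)
  also have "\<dots> \<le> (LINT x|\<nu>. min \<bar>f x\<bar> (K * indicator \<Omega> x))
      + K powr (1 - p) * (LINT x|\<nu>. \<bar>f x\<bar> powr p)"
    using integral_truncation_le[OF V_abs[OF f] _ K(1)] by simp
  also have "(LINT x|\<nu>. min \<bar>f x\<bar> (K * indicator \<Omega> x)) \<le> (LINT x|\<nu>. K * indicator \<Omega> x)"
    using finite_Omega
    by (intro integral_mono) (simp_all add: V_integrable_min V_abs f)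
  also have "K powr (1 - p) * (LINT x|\<nu>. \<bar>f x\<bar> powr p) \<le> En f / (4 * p)"
    using coercive[OF f] p_gt_1 by (simp add: K(2) divide_right_mono)
  finally have "(LINT x|\<nu>. f x) \<le> K * measure \<nu> \<Omega> + En f / (4 * p)"
    by (simp add: int)
  moreover have "En f / (2 * p) = En f / (4 * p) + En f / (4 * p)" by simp
  ultimately show "En f / (4 * p) - K * measure \<nu> \<Omega> \<le> J f"
    unfolding J_def by linarith
qed

text \<open>Coercivity bounds the energy on a sublevel set of \<open>J\<close>, and the Poincare
  inequality turns this into an L^p bound.\<close>

lemma powr_bound_of_J_bound:
  obtains B where "0 \<le> B" "\<And>f. f \<in> V \<Longrightarrow> J f \<le> a \<Longrightarrow> (LINT x|\<nu>. \<bar>f x\<bar> powr p) \<le> B"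
proof -
  obtain C where C: "\<And>f. f \<in> V \<Longrightarrow> En f / (4 * p) - C \<le> J f" by (rule J_coercive) blast
  show ?thesis
  proof
    \<comment> \<open>The maximum with 0 covers the case a + C < 0, in which the sublevel set is
      empty.\<close>
    show "0 \<le> max 0 (4 * p * (a + C) / c)" by simp
    fix f assume f: "f \<in> V" "J f \<le> a"
    have "En f / (4 * p) \<le> a + C" using C[OF f(1)] f(2) by linarith
    then have "En f \<le> 4 * p * (a + C)" using p_gt_1 by (simp add: field_simps)
    then have "c * (LINT x|\<nu>. \<bar>f x\<bar> powr p) \<le> 4 * p * (a + C)"
      using coercive[OF f(1)] by linarith
    then have "(LINT x|\<nu>. \<bar>f x\<bar> powr p) \<le> 4 * p * (a + C) / c"
      using c_pos by (simp add: field_simps)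
    then show "(LINT x|\<nu>. \<bar>f x\<bar> powr p) \<le> max 0 (4 * p * (a + C) / c)" by simp
  qed
qed

text \<open>
  Only the upper bound on \<open>\<integral>u\<^sub>k\<close> in the limit is needed; the \<open>L\<^sup>p\<close> bound makes the
  truncation error \<open>K powr (1 - p)\<close> uniform in \<open>k\<close>.
\<close>

lemma J_lower_semicontinuous:
  assumes u: "\<And>k. u k \<in> V" "\<And>k x. 0 \<le> u k x"
    and a: "\<And>k. J (u k) \<le> a k" "a \<longlonglongrightarrow> A"
    and v: "v \<in> borel_measurable \<nu>" "\<And>x. x \<notin> \<Omega> \<Longrightarrow> v x = 0"
    and lim: "AE x in \<nu>. (\<lambda>k. u k x) \<longlonglongrightarrow> v x"
  shows "v \<in> V" "J v \<le> A"
proof -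
  have [measurable]: "u k \<in> borel_measurable \<nu>" for k using u(1) by (rule V_measurable)
  note v(1)[measurable]
  have "bdd_above (range a)"
    using a(2) by (intro Bseq_bdd_above) (intro convergent_imp_Bseq convergentI)
  then obtain a0 where "J (u k) \<le> a0" for k
    using a(1) by (meson bdd_above.E order_trans range_eqI)
  then obtain B where B: "0 \<le> B" "\<And>k. (LINT x|\<nu>. \<bar>u k x\<bar> powr p) \<le> B"
    using powr_bound_of_J_bound[of a0] u(1) by metis
  have "integrable \<nu> (\<lambda>x. \<bar>v x\<bar> powr p)"
    by (rule integral_abs_powr_le_of_AE_tendsto[where u = u and b = "\<lambda>_. B"])
      (use p_gt_1 u(1) B lim in \<open>auto intro: V_integrable_powr\<close>)
  then show vV: "v \<in> V" using v by (simp add: supported_Lp_def)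
  \<comment> \<open>For fixed K, Fatou's lemma handles the gradients while the linear term is
    replaced by its truncation, which converges by dominated convergence. K is sent to infinity only
    afterwards.\<close>
  have bound: "En v \<le> 2 * p * (A + (LINT x|\<nu>. v x)) + K powr (1 - p) * (2 * p * B)" if "0 < K" for K
  proof -
    define T where "T f = (LINT x|\<nu>. min (f x) (K * indicator \<Omega> x))" for f
    have "(\<lambda>k. T (u k)) \<longlonglongrightarrow> T v"
      unfolding T_def
    proof (rule integral_dominated_convergence)
      show "integrable \<nu> (\<lambda>x. K * indicator \<Omega> x)" using finite_Omega by simp
      show "AE x in \<nu>. (\<lambda>k. min (u k x) (K * indicator \<Omega> x))
          \<longlonglongrightarrow> min (v x) (K * indicator \<Omega> x)"
        using lim by eventually_elim (intro tendsto_intros)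
      show "AE x in \<nu>. norm (min (u k x) (K * indicator \<Omega> x)) \<le> K * indicator \<Omega> x" for k
        using u(2)[of k] \<open>0 < K\<close> by (intro AE_I2) (auto simp: indicator_def)
    qed measurable
    then have b: "(\<lambda>k. 2 * p * (a k + T (u k) + K powr (1 - p) * B))
        \<longlonglongrightarrow> 2 * p * (A + T v + K powr (1 - p) * B)"
      by (intro tendsto_intros a(2))
    have "En v \<le> 2 * p * (A + T v + K powr (1 - p) * B)"
      unfolding energy_def
    proof (rule integral_abs_powr_le_of_AE_tendsto(2)[OF _ _ p_gt_1 _ _ b])
      fix k
      have "(LINT x|\<nu>. u k x) \<le> T (u k) + K powr (1 - p) * (LINT x|\<nu>. \<bar>u k x\<bar> powr p)"
        unfolding T_def by (rule integral_truncation_le[OF u \<open>0 < K\<close>])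
      also have "\<dots> \<le> T (u k) + K powr (1 - p) * B"
        using B(2) by (intro add_left_mono mult_left_mono) auto
      finally have "En (u k) / (2 * p) \<le> a k + T (u k) + K powr (1 - p) * B"
        using a(1)[of k] by (simp add: J_def)
      then show "(LINT z|Q. \<bar>grad (u k) z\<bar> powr p) \<le> 2 * p * (a k + T (u k) + K powr (1 - p) * B)"
        using p_gt_1 by (simp add: energy_def field_simps)
      show "integrable Q (\<lambda>z. \<bar>grad (u k) z\<bar> powr p)" by (rule integrable_grad_powr[OF u(1)])
    next
      show "AE z in Q. (\<lambda>k. grad (u k) z) \<longlonglongrightarrow> grad v z"
        using AE_Q_marginals[OF lim]
        by eventually_elim (auto simp: grad_def case_prod_beta intro!: tendsto_intros)
    qed measurable
    also have "T v \<le> (LINT x|\<nu>. v x)"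
      unfolding T_def by (intro integral_mono V_integrable_min V_integrable vV) auto
    finally show ?thesis using p_gt_1 by (simp add: algebra_simps)
  qed
  have "En v \<le> 2 * p * (A + (LINT x|\<nu>. v x))"
    by (rule le_if_le_add_powr[OF p_gt_1 bound])
  then show "J v \<le> A" using p_gt_1 by (simp add: J_def field_simps)
qed

text \<open>The L^p bound on sublevel sets and monotone convergence make the supremum finite almost
  everywhere; lower semicontinuity then applies.\<close>

lemma J_incseq_limit:
  assumes u: "\<And>k. u k \<in> V" "\<And>k x. 0 \<le> u k x" "\<And>k x. u k x \<le> u (Suc k) x"
    and a: "\<And>k. J (u k) \<le> a"
  obtains v where "v \<in> V" "\<And>x. 0 \<le> v x" "J v \<le> a" "AE x in \<nu>. (\<lambda>k. u k x) \<longlonglongrightarrow> v x"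
proof -
  have [measurable]: "u k \<in> borel_measurable \<nu>" for k using u(1) by (rule V_measurable)
  \<comment> \<open>\<open>lim\<close> is unspecified where the sequence diverges; the absolute
    value keeps v nonnegative there too.\<close>
  define v where "v x = \<bar>lim (\<lambda>k. u k x)\<bar>" for x
  obtain B where B: "0 \<le> B" "\<And>k. (LINT x|\<nu>. \<bar>u k x\<bar> powr p) \<le> B"
    using powr_bound_of_J_bound[of a] u(1) a by metis
  have "(\<integral>\<^sup>+x. (SUP k. ennreal (\<bar>u k x\<bar> powr p)) \<partial>\<nu>)
      = (SUP k. \<integral>\<^sup>+x. ennreal (\<bar>u k x\<bar> powr p) \<partial>\<nu>)"
    using u(2,3) p_gt_1
    by (intro nn_integral_monotone_convergence_SUP incseq_SucI le_funI ennreal_leI powr_mono2) auto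
  also have "\<dots> \<le> ennreal B"
    using B(2) by (intro SUP_least)
      (simp add: nn_integral_eq_integral[OF V_integrable_powr[OF u(1)]] ennreal_leI)
  finally have "(\<integral>\<^sup>+x. (SUP k. ennreal (\<bar>u k x\<bar> powr p)) \<partial>\<nu>) \<noteq> \<infinity>"
    by (auto simp: top_unique)
  then have "AE x in \<nu>. (SUP k. ennreal (\<bar>u k x\<bar> powr p)) \<noteq> \<infinity>"
    by (intro nn_integral_PInf_AE) auto
  then have lim: "AE x in \<nu>. (\<lambda>k. u k x) \<longlonglongrightarrow> v x"
  proof eventually_elim
    case (elim x)
    then obtain S where S: "0 \<le> S" "(SUP k. ennreal (\<bar>u k x\<bar> powr p)) = ennreal S"
      by (cases "SUP k. ennreal (\<bar>u k x\<bar> powr p)") auto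
    have "u k x \<le> S powr (1 / p)" for k
    proof -
      have "ennreal (\<bar>u k x\<bar> powr p) \<le> ennreal S"
        unfolding S(2)[symmetric] by (rule SUP_upper) simp
      then have "(\<bar>u k x\<bar> powr p) powr (1 / p) \<le> S powr (1 / p)"
        using S(1) p_gt_1 by (intro powr_mono2) auto
      then show ?thesis using p_gt_1 u(2)[of k x] by (simp add: powr_powr)
    qed
    then obtain l where l: "(\<lambda>k. u k x) \<longlonglongrightarrow> l"
      using incseq_convergent[OF incseq_SucI, of "\<lambda>k. u k x"] u(3) by metis
    moreover have "0 \<le> l" using u(2) by (intro LIMSEQ_le_const[OF l]) auto
    ultimately show ?case by (simp add: v_def limI)
  qed
  have "v \<in> borel_measurable \<nu>" unfolding v_def by measurable
  moreover have "v x = 0" if "x \<notin> \<Omega>" for x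
    using that u(1) by (simp add: v_def V_zero limI)
  ultimately have "v \<in> V" "J v \<le> a"
    using J_lower_semicontinuous[OF u(1,2) a tendsto_const _ _ lim] by blast+
  moreover have "0 \<le> v x" for x by (simp add: v_def)
  ultimately show ?thesis using lim by (intro that)
qed

lemma ex_J_minimizer:
  obtains f where "f \<in> V" "\<And>x. 0 \<le> f x" "\<And>g. g \<in> V \<Longrightarrow> J f \<le> J g"
proof -
  define I where "I = Inf (J ` V)"
  have ne: "J ` V \<noteq> {}" using V_indicator[of "{}"] by auto
  obtain C where C: "\<And>f. f \<in> V \<Longrightarrow> En f / (4 * p) - C \<le> J f" by (rule J_coercive) blast
  have "- C \<le> J f" if "f \<in> V" for f
    using C[OF that] energy_nonneg[of f] p_gt_1
    by (smt (verit) divide_nonneg_nonneg)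
  then have bdd: "bdd_below (J ` V)" by (intro bdd_belowI2)
  then have I_le: "I \<le> J f" if "f \<in> V" for f
    unfolding I_def using that by (intro cInf_lower) auto
  have "\<exists>f. f \<in> V \<and> (\<forall>x. 0 \<le> f x) \<and> J f \<le> I + (1/2) ^ n" for n
  proof -
    have "Inf (J ` V) < I + (1/2) ^ n" unfolding I_def by simp
    then obtain g where g: "g \<in> V" "J g < I + (1/2) ^ n"
      using cInf_less_iff[OF ne bdd] by auto
    then show ?thesis using V_abs[OF g(1)] J_abs_le[OF g(1)]
      by (intro exI[of _ "\<lambda>x. \<bar>g x\<bar>"]) auto
  qed
  then obtain f where f: "\<And>n. f n \<in> V" "\<And>n x. 0 \<le> f n x" "\<And>n. J (f n) \<le> I + (1/2) ^ n"
    by metis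
  let ?G = "upper_envelope f"
  \<comment> \<open>Submodularity adds the errors of f_n and of the tail, while the minimum costs at
    least \<open>I\<close>. The bound closes because 2^(-n) + 2 * 2^(-(n+1)) = 2 * 2^(-n).\<close>
  have G: "?G k n \<in> V \<and> (\<forall>x. 0 \<le> ?G k n x) \<and> J (?G k n) \<le> I + 2 * (1/2) ^ n" for k n
  proof (induction k arbitrary: n)
    case 0
    have "(1/2) ^ n \<le> 2 * (1/2 :: real) ^ n" by simp
    then have "J (f n) \<le> I + 2 * (1/2) ^ n" using f(3)[of n] by linarith
    then show ?case using f by simp
  next
    case (Suc k)
    have "J (?G (Suc k) n) + I \<le> J (f n) + J (?G k (Suc n))"
      using J_submodular[OF f(1), of "?G k (Suc n)" n] Suc.IH[of "Suc n"]
        I_le[OF V_min[OF f(1)], of "?G k (Suc n)" n] by simp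
    then have "J (?G (Suc k) n) \<le> I + 2 * (1/2) ^ n"
      using f(3)[of n] Suc.IH[of "Suc n"] by simp
    then show ?case
      using Suc.IH[of "Suc n"] f(1,2)[of n] by (auto intro: V_max simp: max.coboundedI1)
  qed
  \<comment> \<open>First limit, k to infinity with n fixed: \<open>h n\<close> is almost everywhere
    the supremum of all f_j with j \<ge> n.\<close>
  have "\<forall>n. \<exists>h. h \<in> V \<and> (\<forall>x. 0 \<le> h x) \<and> J h \<le> I + 2 * (1/2) ^ n \<and>
      (AE x in \<nu>. (\<lambda>k. ?G k n x) \<longlonglongrightarrow> h x)"
  proof
    fix n
    show "\<exists>h. h \<in> V \<and> (\<forall>x. 0 \<le> h x) \<and> J h \<le> I + 2 * (1/2) ^ n \<and>
        (AE x in \<nu>. (\<lambda>k. ?G k n x) \<longlonglongrightarrow> h x)"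
    proof (rule J_incseq_limit)
      show "?G k n \<in> V" "0 \<le> ?G k n x" "J (?G k n) \<le> I + 2 * (1/2) ^ n" for k x
        using G by blast+
      show "?G k n x \<le> ?G (Suc k) n x" for k x by (rule upper_envelope_Suc_le)
    qed blast
  qed
  from choice[OF this] obtain h where h: "\<And>n. h n \<in> V" "\<And>n x. 0 \<le> h n x"
      "\<And>n. J (h n) \<le> I + 2 * (1/2) ^ n"
      "\<And>n. AE x in \<nu>. (\<lambda>k. ?G k n x) \<longlonglongrightarrow> h n x"
    by blast
  have [measurable]: "h n \<in> borel_measurable \<nu>" for n using h(1) by (rule V_measurable)
  define v where "v x = \<bar>lim (\<lambda>n. h n x)\<bar>" for x
  have "AE x in \<nu>. \<forall>n. (\<lambda>k. ?G k n x) \<longlonglongrightarrow> h n x"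
    using h(4) by (simp add: AE_all_countable)
  then have lim: "AE x in \<nu>. (\<lambda>n. h n x) \<longlonglongrightarrow> v x"
  proof eventually_elim
    case (elim x)
    \<comment> \<open>Dropping f_n from the maximum cannot increase it, so the suprema decrease in n
      and their limit is the limsup of the f_n.\<close>
    have "h (Suc n) x \<le> h n x" for n
    proof (rule LIMSEQ_le)
      show "(\<lambda>k. ?G k (Suc n) x) \<longlonglongrightarrow> h (Suc n) x" using elim by simp
      show "(\<lambda>k. ?G (Suc k) n x) \<longlonglongrightarrow> h n x"
        using elim LIMSEQ_Suc by blast
    qed auto
    then obtain l where l: "(\<lambda>n. h n x) \<longlonglongrightarrow> l"
      using decseq_convergent[OF decseq_SucI, of "\<lambda>n. h n x" 0] h(2) by metis
    moreover have "0 \<le> l" using h(2) by (intro LIMSEQ_le_const[OF l]) auto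
    ultimately show ?case by (simp add: v_def limI)
  qed
  have "(\<lambda>n. I + 2 * (1/2) ^ n) \<longlonglongrightarrow> I + 2 * (0::real)"
    by (intro tendsto_intros LIMSEQ_power_zero) auto
  then have to_I: "(\<lambda>n. I + 2 * (1/2) ^ n) \<longlonglongrightarrow> I" by simp
  have "v \<in> borel_measurable \<nu>" unfolding v_def by measurable
  moreover have "v x = 0" if "x \<notin> \<Omega>" for x
    using that h(1) by (simp add: v_def V_zero limI)
  ultimately have "v \<in> V" "J v \<le> I"
    using J_lower_semicontinuous[OF h(1,2,3) to_I _ _ lim] by blast+
  moreover have "0 \<le> v x" for x by (simp add: v_def)
  ultimately show ?thesis
    using I_le by (intro that[of v]) (auto intro: order_trans)
qed

end

section \<open>Euler-Lagrange equation of \<open>J\<close> and the inequalities obtained by testing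
  it\<close>

section \<open>The weak torsion equation\<close>

context nonlocal_energy
begin

definition weak_solution :: "('a \<Rightarrow> real) \<Rightarrow> bool" where
  "weak_solution f \<longleftrightarrow> f \<in> V \<and>
    (\<forall>g\<in>V. 1 / 2 * (LINT z|Q. pflux p (grad f z) * grad g z) = (LINT x|\<nu>. g x))"

text \<open>One-sided derivative of \<open>J\<close> at f along g. The tangent inequality is taken
  at the perturbed point f + t g, which gives a bound for each t > 0 and leaves only a limit of
  fluxes to compute.\<close>

lemma J_minimizer_first_variation:
  assumes f: "f \<in> V" and min: "\<And>g. g \<in> V \<Longrightarrow> J f \<le> J g" and g: "g \<in> V"
  shows "(LINT x|\<nu>. g x) \<le> 1 / 2 * (LINT z|Q. pflux p (grad f z) * grad g z)"
proof -
  have [measurable]: "f \<in> borel_measurable \<nu>" "g \<in> borel_measurable \<nu>"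
    using f g by (auto intro: V_measurable)
  define t where "t n = 1 / real (Suc n)" for n
  have t: "0 < t n" "\<bar>t n\<bar> \<le> 1" for n by (auto simp: t_def)
  have t_lim: "t \<longlonglongrightarrow> 0"
    unfolding t_def using LIMSEQ_inverse_real_of_nat by (simp add: inverse_eq_divide)
  let ?F = "\<lambda>n z. pflux p (grad f z + t n * grad g z) * grad g z"
  have ft: "(\<lambda>x. f x + t n * g x) \<in> V" for n
    using f g by (intro V_add V_scale)
  have int_F: "integrable Q (?F n)" for n
    using integrable_pflux_grad[OF ft g] by (simp add: grad_add_scale)
  have lower: "(LINT x|\<nu>. g x) \<le> 1 / 2 * (LINT z|Q. ?F n z)" for n
  proof -
    let ?h = "\<lambda>x. f x + t n * g x"
    have "En ?h - p * t n * (LINT z|Q. ?F n z)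
        = (LINT z|Q. \<bar>grad ?h z\<bar> powr p - p * t n * ?F n z)"
      unfolding energy_def using int_F integrable_grad_powr[OF ft]
      by (subst Bochner_Integration.integral_diff) auto
    also have "\<dots> \<le> (LINT z|Q. \<bar>grad f z\<bar> powr p)"
    proof (rule integral_mono)
      show "\<bar>grad ?h z\<bar> powr p - p * t n * ?F n z \<le> \<bar>grad f z\<bar> powr p" for z
        using abs_powr_tangent[OF p_gt_1, of "grad f z + t n * grad g z" "grad f z"]
        unfolding grad_add_scale by (simp add: algebra_simps)
    qed (use int_F in \<open>simp_all add: integrable_grad_powr f ft\<close>)
    finally have "En ?h \<le> En f + p * t n * (LINT z|Q. ?F n z)"
      by (simp add: energy_def)
    then have "En ?h / (2 * p) \<le> (En f + p * t n * (LINT z|Q. ?F n z)) / (2 * p)"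
      using p_gt_1 by (intro divide_right_mono) auto
    also have "\<dots> = En f / (2 * p) + t n * (1 / 2 * (LINT z|Q. ?F n z))"
      using p_gt_1 by (simp add: field_simps)
    finally have "En ?h / (2 * p) \<le> En f / (2 * p) + t n * (1 / 2 * (LINT z|Q. ?F n z))" .
    moreover have "(LINT x|\<nu>. ?h x) = (LINT x|\<nu>. f x) + t n * (LINT x|\<nu>. g x)"
      by (simp add: V_integrable f g)
    ultimately have "t n * (LINT x|\<nu>. g x) \<le> t n * (1 / 2 * (LINT z|Q. ?F n z))"
      using min[OF ft, of n] by (simp add: J_def)
    then show ?thesis using t(1) by (rule mult_left_le_imp_le)
  qed
  have "(\<lambda>n. LINT z|Q. ?F n z) \<longlonglongrightarrow> (LINT z|Q. pflux p (grad f z) * grad g z)"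
  proof (rule integral_dominated_convergence)
    \<comment> \<open>A majorant independent of n, from Young's inequality and |t| \<le> 1.\<close>
    let ?D = "\<lambda>z. 2 powr p * (\<bar>grad f z\<bar> powr p + \<bar>grad g z\<bar> powr p) + \<bar>grad g z\<bar> powr p"
    show "integrable Q ?D"
      using integrable_grad_powr[OF f] integrable_grad_powr[OF g] by auto
    show "AE z in Q. (\<lambda>n. ?F n z) \<longlonglongrightarrow> pflux p (grad f z) * grad g z"
    proof (intro AE_I2 tendsto_mult tendsto_const)
      fix z
      have "(\<lambda>n. grad f z + t n * grad g z) \<longlonglongrightarrow> grad f z + 0 * grad g z"
        by (intro tendsto_intros t_lim)
      then show "(\<lambda>n. pflux p (grad f z + t n * grad g z)) \<longlonglongrightarrow> pflux p (grad f z)"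
        using isCont_tendsto_compose[OF isCont_pflux[OF p_gt_1]] by simp
    qed
    fix n
    have "\<bar>?F n z\<bar> \<le> ?D z" for z
    proof -
      have "\<bar>?F n z\<bar> \<le> (1 - 1 / p) * \<bar>grad f z + t n * grad g z\<bar> powr p + \<bar>grad g z\<bar> powr p / p"
        by (rule pflux_Young[OF p_gt_1])
      also have "\<dots> \<le> 1 * \<bar>grad f z + t n * grad g z\<bar> powr p + \<bar>grad g z\<bar> powr p"
        using p_gt_1 by (intro add_mono mult_right_mono divide_le_eq_1[THEN iffD2])
          (auto simp: divide_le_eq mult_le_cancel_left1)
      also have "\<bar>grad f z + t n * grad g z\<bar> powr p
          \<le> 2 powr p * (\<bar>grad f z\<bar> powr p + \<bar>t n * grad g z\<bar> powr p)"
        by (rule abs_powr_add_le[OF p_gt_1])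
      also have "\<bar>t n * grad g z\<bar> powr p \<le> \<bar>grad g z\<bar> powr p"
        using t(2)[of n] p_gt_1
        by (intro powr_mono2) (auto simp: abs_mult mult_left_le_one_le)
      finally show ?thesis by simp
    qed
    then show "AE z in Q. norm (?F n z) \<le> ?D z" by simp
  qed measurable
  then have "(\<lambda>n. 1 / 2 * (LINT z|Q. ?F n z))
      \<longlonglongrightarrow> 1 / 2 * (LINT z|Q. pflux p (grad f z) * grad g z)"
    by (rule tendsto_mult_left)
  then show ?thesis by (rule LIMSEQ_le_const) (use lower in blast)
qed

lemma J_minimizer_weak_solution:
  assumes f: "f \<in> V" and min: "\<And>g. g \<in> V \<Longrightarrow> J f \<le> J g"
  shows "weak_solution f"
  unfolding weak_solution_def
proof (intro conjI ballI antisym)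
  fix g assume g: "g \<in> V"
  show "(LINT x|\<nu>. g x) \<le> 1 / 2 * (LINT z|Q. pflux p (grad f z) * grad g z)"
    by (rule J_minimizer_first_variation[OF f min g])
  have "(LINT x|\<nu>. - g x) \<le> 1 / 2 * (LINT z|Q. pflux p (grad f z) * grad (\<lambda>x. - g x) z)"
    using J_minimizer_first_variation[OF f min V_scale[OF g, of "- 1"]] by simp
  moreover have "grad (\<lambda>x. - g x) z = - grad g z" for z
    by (simp add: grad_def case_prod_beta)
  ultimately show "1 / 2 * (LINT z|Q. pflux p (grad f z) * grad g z) \<le> (LINT x|\<nu>. g x)"
    by simp
qed (fact f)

lemma weak_solution_integral:
  assumes "weak_solution f"
  shows "(LINT x|\<nu>. f x) = En f / 2"
  using assms by (auto simp: weak_solution_def energy_def pflux_mult_self)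

text \<open>Testing with t |g| keeps a scale free to be chosen later; the reverse triangle
  inequality passes from |g| back to g.\<close>

lemma weak_solution_Young:
  assumes f: "weak_solution f" and g: "g \<in> V" and "0 < t"
  shows "t * (LINT x|\<nu>. \<bar>g x\<bar>) \<le> (1 - 1 / p) * (En f / 2) + t powr p * (En g / 2) / p"
proof -
  have fV: "f \<in> V" using f by (simp add: weak_solution_def)
  let ?h = "\<lambda>x. t * \<bar>g x\<bar>"
  have h: "?h \<in> V" by (rule V_scale[OF V_abs[OF g]])
  have "t * (LINT x|\<nu>. \<bar>g x\<bar>) = (LINT x|\<nu>. ?h x)" by simp
  also have "\<dots> = 1 / 2 * (LINT z|Q. pflux p (grad f z) * grad ?h z)"
    using f h by (simp add: weak_solution_def)
  also have "(LINT z|Q. pflux p (grad f z) * grad ?h z)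
      \<le> (LINT z|Q. (1 - 1 / p) * \<bar>grad f z\<bar> powr p + t powr p * \<bar>grad g z\<bar> powr p / p)"
  proof (rule integral_mono)
    fix z
    have "pflux p (grad f z) * grad ?h z \<le> (1 - 1 / p) * \<bar>grad f z\<bar> powr p + \<bar>grad ?h z\<bar> powr p / p"
      using pflux_Young[OF p_gt_1, of "grad f z" "grad ?h z"] by linarith
    also have "\<bar>grad ?h z\<bar> powr p \<le> (t * \<bar>grad g z\<bar>) powr p"
      using \<open>0 < t\<close> p_gt_1
      by (intro powr_mono2)
        (auto simp: grad_def case_prod_beta abs_mult simp flip: right_diff_distrib)
    also have "(t * \<bar>grad g z\<bar>) powr p = t powr p * \<bar>grad g z\<bar> powr p"
      using \<open>0 < t\<close> by (simp add: powr_mult)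
    finally show "pflux p (grad f z) * grad ?h z
        \<le> (1 - 1 / p) * \<bar>grad f z\<bar> powr p + t powr p * \<bar>grad g z\<bar> powr p / p"
      using p_gt_1 by (simp add: divide_right_mono)
  qed (use fV g h in \<open>simp_all add: integrable_pflux_grad integrable_grad_powr\<close>)
  also have "\<dots> = (1 - 1 / p) * En f + t powr p * En g / p"
    using fV g by (simp add: energy_def integrable_grad_powr)
  finally show ?thesis by (simp add: algebra_simps diff_divide_distrib)
qed

text \<open>Otherwise f has no positive energy either, and testing with the indicator of \<Omega> at
  scale t = 1 / K bounds the measure of \<Omega> by a fixed multiple of K^(1-p) for every K >
  0.\<close>

lemma weak_solution_integral_pos:
  assumes f: "weak_solution f" and "0 < emeasure \<nu> \<Omega>"
  shows "0 < (LINT x|\<nu>. f x)"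
proof (rule ccontr)
  assume "\<not> 0 < (LINT x|\<nu>. f x)"
  then have "En f / 2 \<le> 0" using weak_solution_integral[OF f] by simp
  let ?g = "indicator \<Omega> :: 'a \<Rightarrow> real"
  have g: "?g \<in> V" by (rule V_indicator) auto
  have le: "measure \<nu> \<Omega> \<le> 0 + K powr (1 - p) * (En ?g / 2 / p)" if "0 < K" for K
  proof -
    have "(1 / K) * measure \<nu> \<Omega> \<le> (1 - 1 / p) * (En f / 2) + (1 / K) powr p * (En ?g / 2) / p"
      using weak_solution_Young[OF f g, of "1 / K"] that finite_Omega by simp
    also have "(1 - 1 / p) * (En f / 2) \<le> 0"
      using \<open>En f / 2 \<le> 0\<close> p_gt_1 by (intro mult_nonneg_nonpos) auto
    finally have "K * ((1 / K) * measure \<nu> \<Omega>) \<le> K * ((1 / K) powr p * (En ?g / 2) / p)"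
      using that by (intro mult_left_mono) auto
    moreover have e: "K * (1 / K) powr p = K powr (1 - p)"
      using that by (simp add: powr_diff powr_divide)
    have "K * ((1 / K) powr p * (En ?g / 2) / p) = K powr (1 - p) * (En ?g / 2 / p)"
      by (simp flip: e)
    moreover have "K * ((1 / K) * measure \<nu> \<Omega>) = measure \<nu> \<Omega>" using that by simp
    ultimately show ?thesis by linarith
  qed
  have "measure \<nu> \<Omega> \<le> 0"
    by (rule le_if_le_add_powr[OF p_gt_1 le])
  moreover have "0 < measure \<nu> \<Omega>"
    using assms(2) finite_Omega by (simp add: measure_def enn2real_positive_iff)
  ultimately show False by simp
qed

text \<open>
  Hoelder's inequality enters here as Young's inequality optimised over the scaling \<open>t\<close>.
\<close>

lemma weak_solution_quotient_bound:
  assumes f: "weak_solution f" and g: "g \<in> V" and "0 < emeasure \<nu> \<Omega>"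
  shows "(LINT x|\<nu>. \<bar>g x\<bar>) powr p \<le> (LINT x|\<nu>. f x) powr (p - 1) * (1 / 2 * En g)"
proof -
  define A where "A = (LINT x|\<nu>. f x)"
  define G where "G = (LINT x|\<nu>. \<bar>g x\<bar>)"
  define B where "B = En g / 2"
  have A: "0 < A" "En f / 2 = A"
    using weak_solution_integral_pos[OF f assms(3)] weak_solution_integral[OF f]
    by (auto simp: A_def)
  have "0 \<le> G" by (simp add: G_def)
  show ?thesis
  proof (cases "G = 0")
    case True
    then show ?thesis
      using p_gt_1 by (simp add: G_def energy_def)
  next
    case False
    then have "0 < G" using \<open>0 \<le> G\<close> by simp
    \<comment> \<open>The scale t = A / G makes the left side equal to A, so that A - (1 - 1 / p) A
      = A / p remains.\<close>
    have "A / G * G \<le> (1 - 1 / p) * A + (A / G) powr p * B / p"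
      using weak_solution_Young[OF f g, of "A / G"] A \<open>0 < G\<close> by (simp add: G_def B_def)
    then have "A / p \<le> (A / G) powr p * B / p"
      using \<open>0 < G\<close> by (simp add: algebra_simps)
    then have "A \<le> (A / G) powr p * B"
      using p_gt_1 by (simp add: divide_le_cancel)
    then have "A \<le> A powr p / G powr p * B"
      using A \<open>0 < G\<close> by (simp add: powr_divide)
    then have "A * G powr p \<le> A powr p * B"
      using \<open>0 < G\<close> by (simp add: field_simps)
    also have "A powr p = A * A powr (p - 1)"
      using A by (simp add: powr_diff)
    finally show ?thesis
      using A by (simp add: A_def G_def B_def mult.assoc)
  qed
qed

end

section \<open>Fubini's theorem, reversibility and null sets for the walk measure\<close>

section \<open>Disintegration of the walk measure\<close>

context reversible_random_walk_space
begin

lemma kernel_subprob [measurable]: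
  "m \<in> \<nu> \<rightarrow>\<^sub>M subprob_algebra \<nu>"
  using kernel by (rule measurable_prob_algebraD)

lemma sets_kernel [simp]:
  "x \<in> space \<nu> \<Longrightarrow> sets (m x) = sets \<nu>"
  using measurable_space[OF kernel_subprob] by (simp add: space_subprob_algebra)

lemma space_kernel [simp]:
  "x \<in> space \<nu> \<Longrightarrow> space (m x) = space \<nu>"
  by (intro sets_eq_imp_space_eq sets_kernel)

lemma emeasure_kernel_space:
  "x \<in> space \<nu> \<Longrightarrow> emeasure (m x) (space \<nu>) = 1"
  using measurable_space[OF kernel, of x] prob_space.emeasure_space_1[of "m x"]
  by (simp add: space_prob_algebra)

lemma measurable_distr_Pair:
  "(\<lambda>x. distr (m x) (\<nu> \<Otimes>\<^sub>M \<nu>) (Pair x)) \<in> \<nu> \<rightarrow>\<^sub>M subprob_algebra (\<nu> \<Otimes>\<^sub>M \<nu>)"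
  by (rule measurable_distr2[OF _ kernel_subprob]) simp

lemma measurable_Pair_kernel:
  "x \<in> space \<nu> \<Longrightarrow> Pair x \<in> m x \<rightarrow>\<^sub>M \<nu> \<Otimes>\<^sub>M \<nu>"
  using measurable_Pair1'[of x \<nu> \<nu>] measurable_cong_sets[OF sets_kernel refl] by blast

lemma nn_integral_walk_measure:
  assumes [measurable]: "f \<in> borel_measurable (\<nu> \<Otimes>\<^sub>M \<nu>)"
  shows "(\<integral>\<^sup>+z. f z \<partial>walk_measure \<nu> m) = (\<integral>\<^sup>+x. \<integral>\<^sup>+y. f (x, y) \<partial>m x \<partial>\<nu>)"
  unfolding walk_measure_def
  by (subst nn_integral_bind[OF assms measurable_distr_Pair])
    (auto intro!: nn_integral_cong simp: nn_integral_distr[OF measurable_Pair_kernel])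

lemma sets_walk_measure:
  assumes "space \<nu> \<noteq> {}"
  shows "sets (walk_measure \<nu> m) = sets (\<nu> \<Otimes>\<^sub>M \<nu>)"
  unfolding walk_measure_def using assms by (intro sets_bind) auto

lemma nn_integral_walk_measure_fst:
  assumes [measurable]: "h \<in> borel_measurable \<nu>"
  shows "(\<integral>\<^sup>+z. h (fst z) \<partial>walk_measure \<nu> m) = (\<integral>\<^sup>+x. h x \<partial>\<nu>)"
  by (subst nn_integral_walk_measure)
    (auto intro!: nn_integral_cong simp: emeasure_kernel_space)

lemma nn_integral_walk_measure_swap:
  assumes ne: "space \<nu> \<noteq> {}" and "f \<in> borel_measurable (\<nu> \<Otimes>\<^sub>M \<nu>)"
  shows "(\<integral>\<^sup>+z. f (snd z, fst z) \<partial>walk_measure \<nu> m) = (\<integral>\<^sup>+z. f z \<partial>walk_measure \<nu> m)"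
proof -
  note [measurable_cong] = sets_walk_measure[OF ne]
  have "(\<integral>\<^sup>+z. f z \<partial>walk_measure \<nu> m)
      = (\<integral>\<^sup>+z. f z \<partial>distr (walk_measure \<nu> m) (\<nu> \<Otimes>\<^sub>M \<nu>) (\<lambda>(x, y). (y, x)))"
    by (simp add: reversible)
  also have "\<dots> = (\<integral>\<^sup>+z. f (snd z, fst z) \<partial>walk_measure \<nu> m)"
    using assms(2) by (subst nn_integral_distr) (auto simp: case_prod_beta)
  finally show ?thesis by simp
qed

text \<open>By reversibility the second marginal is also \<nu>, so for a \<nu>-null set N the
  integral of m_x(N) against \<nu> equals \<nu>(N) = 0.\<close>

lemma AE_kernel:
  assumes ne: "space \<nu> \<noteq> {}" and P: "AE y in \<nu>. P y"
  shows "AE x in \<nu>. AE y in m x. P y"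
proof -
  obtain N where N: "N \<in> null_sets \<nu>" "{y \<in> space \<nu>. \<not> P y} \<subseteq> N"
    using P by (auto simp: eventually_ae_filter)
  then have [measurable]: "N \<in> sets \<nu>" by auto
  have "(\<integral>\<^sup>+x. emeasure (m x) N \<partial>\<nu>) = (\<integral>\<^sup>+z. indicator N (snd z) \<partial>walk_measure \<nu> m)"
    by (subst nn_integral_walk_measure) (auto intro!: nn_integral_cong)
  also have "\<dots> = (\<integral>\<^sup>+z. indicator N (fst z) \<partial>walk_measure \<nu> m)"
    using nn_integral_walk_measure_swap[OF ne, of "\<lambda>z. indicator N (fst z)"] by simp
  also have "\<dots> = 0"
    using N(1) by (subst nn_integral_walk_measure_fst) auto
  finally have "AE x in \<nu>. emeasure (m x) N = 0"
    by (subst (asm) nn_integral_0_iff_AE) auto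
  then show ?thesis
    using AE_space
  proof eventually_elim
    case (elim x)
    then have "N \<in> null_sets (m x)" by (auto simp: null_sets_def)
    then show ?case
      by (rule AE_I'[of N]) (use elim N(2) in auto)
  qed
qed

text \<open>Fubini for a kernel, obtained from the nonnegative version applied to the positive and
  negative parts separately.\<close>

lemma
  fixes G :: "'a \<times> 'a \<Rightarrow> real"
  assumes ne: "space \<nu> \<noteq> {}" and int: "integrable (walk_measure \<nu> m) G"
  shows integrable_walk_measure_section: "integrable \<nu> (\<lambda>x. LINT y|m x. G (x, y))"
    and integral_walk_measure:
      "(LINT z|walk_measure \<nu> m. G z) = (LINT x|\<nu>. LINT y|m x. G (x, y))"
proof -
  note [measurable_cong] = sets_walk_measure[OF ne]
  have G [measurable]: "G \<in> borel_measurable (\<nu> \<Otimes>\<^sub>M \<nu>)" using int by measurable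
  have sec: "(\<lambda>y. G (x, y)) \<in> borel_measurable (m x)" if "x \<in> space \<nu>" for x
    using measurable_compose[OF measurable_Pair_kernel[OF that] G] .
  define P where "P x = (\<integral>\<^sup>+y. ennreal (G (x, y)) \<partial>m x)" for x
  define N where "N x = (\<integral>\<^sup>+y. ennreal (- G (x, y)) \<partial>m x)" for x
  have [measurable]: "P \<in> borel_measurable \<nu>" "N \<in> borel_measurable \<nu>"
    unfolding P_def N_def
    by (rule nn_integral_measurable_subprob_algebra2[OF _ kernel_subprob], measurable)+
  have eq: "(\<integral>\<^sup>+x. P x \<partial>\<nu>) = (\<integral>\<^sup>+z. ennreal (G z) \<partial>walk_measure \<nu> m)"
      "(\<integral>\<^sup>+x. N x \<partial>\<nu>) = (\<integral>\<^sup>+z. ennreal (- G z) \<partial>walk_measure \<nu> m)"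
    unfolding P_def N_def by (subst nn_integral_walk_measure; simp)+
  have fin: "(\<integral>\<^sup>+x. P x \<partial>\<nu>) \<noteq> \<infinity>" "(\<integral>\<^sup>+x. N x \<partial>\<nu>) \<noteq> \<infinity>"
    unfolding eq using int by (auto simp: real_integrable_def)
  have AE_fin: "AE x in \<nu>. P x \<noteq> \<infinity>" "AE x in \<nu>. N x \<noteq> \<infinity>"
    using nn_integral_PInf_AE[OF _ fin(1)] nn_integral_PInf_AE[OF _ fin(2)] by measurable
  \<comment> \<open>Only almost everywhere: where \<open>P\<close> or \<open>N\<close> is infinite,
    the Bochner integral of the section takes its default value 0.\<close>
  have sect_eq: "AE x in \<nu>. (LINT y|m x. G (x, y)) = enn2real (P x) - enn2real (N x)"
    using AE_fin AE_space
  proof eventually_elim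
    case (elim x)
    then have "integrable (m x) (\<lambda>y. G (x, y))"
      using sec by (auto simp: real_integrable_def P_def N_def)
    then show ?case by (simp add: real_lebesgue_integral_def P_def N_def)
  qed
  have enn2real_PN: "(\<integral>\<^sup>+x. ennreal (enn2real (P x)) \<partial>\<nu>) = (\<integral>\<^sup>+x. P x \<partial>\<nu>)"
      "(\<integral>\<^sup>+x. ennreal (enn2real (N x)) \<partial>\<nu>) = (\<integral>\<^sup>+x. N x \<partial>\<nu>)"
    using AE_fin by (auto intro!: nn_integral_cong_AE simp: less_top)
  have int_PN: "integrable \<nu> (\<lambda>x. enn2real (P x))" "integrable \<nu> (\<lambda>x. enn2real (N x))"
    using enn2real_PN fin by (auto intro!: integrableI_bounded simp: less_top)
  have val_PN: "(LINT x|\<nu>. enn2real (P x)) = enn2real (\<integral>\<^sup>+x. P x \<partial>\<nu>)"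
      "(LINT x|\<nu>. enn2real (N x)) = enn2real (\<integral>\<^sup>+x. N x \<partial>\<nu>)"
    by (subst integral_eq_nn_integral; simp add: enn2real_PN)+
  \<comment> \<open>The section integral is an integral over the pushforward of m_x to pairs, and
    this measure depends measurably on x.\<close>
  have "(\<lambda>x. LINT y|m x. G (x, y)) \<in> borel_measurable \<nu>
      \<longleftrightarrow> (\<lambda>x. LINT z|distr (m x) (\<nu> \<Otimes>\<^sub>M \<nu>) (Pair x). G z) \<in> borel_measurable \<nu>"
    by (intro measurable_cong) (simp add: integral_distr[OF measurable_Pair_kernel G])
  then have [measurable]: "(\<lambda>x. LINT y|m x. G (x, y)) \<in> borel_measurable \<nu>"
    using measurable_compose[OF measurable_distr_Pair integral_measurable_subprob_algebra[OF G]]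
    by blast
  show "integrable \<nu> (\<lambda>x. LINT y|m x. G (x, y))"
    using sect_eq int_PN by (subst integrable_cong_AE[OF _ _ sect_eq]) auto
  have "(LINT x|\<nu>. LINT y|m x. G (x, y)) = (LINT x|\<nu>. enn2real (P x) - enn2real (N x))"
    by (rule integral_cong_AE[OF _ _ sect_eq]) auto
  also have "\<dots> = (LINT z|walk_measure \<nu> m. G z)"
    using int int_PN by (simp add: val_PN eq real_lebesgue_integral_def)
  finally show "(LINT z|walk_measure \<nu> m. G z) = (LINT x|\<nu>. LINT y|m x. G (x, y))" by simp
qed

end

section \<open>The torsion equation on the closure of \<Omega>: pointwise and weak forms\<close>

section \<open>Torsional functions\<close>

text \<open>The nonlocal p-Laplacian on the closure of \<Omega>.\<close>

definition flux_divergence ::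
    "'a measure \<Rightarrow> ('a \<Rightarrow> 'a measure) \<Rightarrow> real \<Rightarrow> 'a set \<Rightarrow> ('a \<Rightarrow> real) \<Rightarrow> 'a \<Rightarrow> real" where
  "flux_divergence \<nu> m p \<Omega> f x = (LINT y : m_closure \<nu> m \<Omega> | m x. pflux p (f y - f x))"

locale torsion_problem = reversible_random_walk_space \<nu> m
  for \<nu> :: "'a measure" and m :: "'a \<Rightarrow> 'a measure" +
  fixes \<Omega> :: "'a set" and p c :: real
  assumes p_gt_1: "1 < p"
    and sets_Omega [measurable]: "\<Omega> \<in> sets \<nu>"
    and pos_Omega: "0 < emeasure \<nu> \<Omega>"
    and finite_closure: "emeasure \<nu> (m_closure \<nu> m \<Omega>) < \<infinity>"
    and c_pos: "0 < c"
    and poincare: "\<And>f. f \<in> Lp0 \<nu> m p \<Omega> \<Longrightarrow>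
      c * (LINT x : \<Omega> | \<nu>. \<bar>f x\<bar> powr p) \<le> grad_energy \<nu> m p \<Omega> f"
begin

abbreviation "S \<equiv> m_closure \<nu> m \<Omega>"

text \<open>The density absorbs the restriction to \<open>S \<times> S\<close>, turning set
  integrals over pairs into plain ones.\<close>

definition Q :: "('a \<times> 'a) measure" where
  "Q = density (walk_measure \<nu> m) (\<lambda>z. ennreal (indicator (S \<times> S) z))"

lemma space_ne: "space \<nu> \<noteq> {}"
  using pos_Omega sets.sets_into_space[OF sets_Omega] by auto

lemmas sets_W [measurable_cong] = sets_walk_measure[OF space_ne]

lemma sets_S [measurable]: "S \<in> sets \<nu>"
  unfolding m_closure_def m_boundary_def by measurable

lemma Omega_subset_S: "\<Omega> \<subseteq> S"
  by (simp add: m_closure_def)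

lemma sets_density_Q [measurable_cong]: "sets Q = sets (\<nu> \<Otimes>\<^sub>M \<nu>)"
  by (simp add: Q_def sets_W)

lemma nn_integral_Q:
  assumes [measurable]: "f \<in> borel_measurable (\<nu> \<Otimes>\<^sub>M \<nu>)"
  shows "(\<integral>\<^sup>+z. f z \<partial>Q) = (\<integral>\<^sup>+z. indicator (S \<times> S) z * f z \<partial>walk_measure \<nu> m)"
  unfolding Q_def by (subst nn_integral_density) (auto simp: ennreal_indicator)

lemma integral_Q:
  fixes f :: "'a \<times> 'a \<Rightarrow> real"
  assumes [measurable]: "f \<in> borel_measurable (\<nu> \<Otimes>\<^sub>M \<nu>)"
  shows "(LINT z|Q. f z) = (LINT z : S \<times> S | walk_measure \<nu> m. f z)"
  unfolding Q_def by (subst integral_density) (auto simp: set_lebesgue_integral_def)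

lemma integrable_Q:
  fixes f :: "'a \<times> 'a \<Rightarrow> real"
  assumes [measurable]: "f \<in> borel_measurable (\<nu> \<Otimes>\<^sub>M \<nu>)"
  shows "integrable Q f \<longleftrightarrow> set_integrable (walk_measure \<nu> m) (S \<times> S) f"
  unfolding Q_def by (subst integrable_density) (auto simp: set_integrable_def)

lemma grad_energy_eq:
  assumes [measurable]: "f \<in> borel_measurable \<nu>"
  shows "grad_energy \<nu> m p \<Omega> f = energy Q p f"
  unfolding grad_energy_def energy_def by (rule integral_Q[symmetric]) measurable

text \<open>Symmetry follows from reversibility because \<open>S \<times> S\<close> is itself
  symmetric; the restriction can only lower the marginal.\<close>

sublocale nonlocal_energy \<nu> Q \<Omega> p
proof
  show "1 < p" "\<Omega> \<in> sets \<nu>" "sets Q = sets (\<nu> \<Otimes>\<^sub>M \<nu>)"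
    by (fact p_gt_1 sets_Omega sets_density_Q)+
  show "emeasure \<nu> \<Omega> < \<infinity>"
    using emeasure_mono[OF Omega_subset_S sets_S] finite_closure by (rule le_less_trans)
  show "distr Q (\<nu> \<Otimes>\<^sub>M \<nu>) (\<lambda>(x, y). (y, x)) = Q"
  proof (rule measure_eqI)
    fix A assume "A \<in> sets (distr Q (\<nu> \<Otimes>\<^sub>M \<nu>) (\<lambda>(x, y). (y, x)))"
    then have [measurable]: "A \<in> sets (\<nu> \<Otimes>\<^sub>M \<nu>)" by simp
    have "emeasure (distr Q (\<nu> \<Otimes>\<^sub>M \<nu>) (\<lambda>(x, y). (y, x))) A
        = (\<integral>\<^sup>+z. indicator A z \<partial>distr Q (\<nu> \<Otimes>\<^sub>M \<nu>) (\<lambda>(x, y). (y, x)))"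
      by simp
    also have "\<dots> = (\<integral>\<^sup>+z. indicator A (snd z, fst z) \<partial>Q)"
      by (subst nn_integral_distr) (auto simp: case_prod_beta)
    also have "\<dots> = (\<integral>\<^sup>+z. indicator (S \<times> S) (snd z, fst z) * indicator A (snd z, fst z)
        \<partial>walk_measure \<nu> m)"
      by (subst nn_integral_Q) (auto intro!: nn_integral_cong simp: indicator_def)
    also have "\<dots> = (\<integral>\<^sup>+z. indicator (S \<times> S) z * indicator A z \<partial>walk_measure \<nu> m)"
      by (rule nn_integral_walk_measure_swap[OF space_ne,
          of "\<lambda>z. indicator (S \<times> S) z * indicator A z"]) measurable
    also have "\<dots> = (\<integral>\<^sup>+z. indicator A z \<partial>Q)"
      by (subst nn_integral_Q) auto
    also have "\<dots> = emeasure Q A"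
      by (simp add: sets_density_Q)
    finally show "emeasure (distr Q (\<nu> \<Otimes>\<^sub>M \<nu>) (\<lambda>(x, y). (y, x))) A = emeasure Q A" .
  qed (simp add: sets_density_Q)
  show "(\<integral>\<^sup>+z. h (fst z) \<partial>Q) \<le> (\<integral>\<^sup>+x. h x \<partial>\<nu>)" if [measurable]: "h \<in> borel_measurable \<nu>" for h
  proof -
    have "(\<integral>\<^sup>+z. h (fst z) \<partial>Q) = (\<integral>\<^sup>+z. indicator (S \<times> S) z * h (fst z) \<partial>walk_measure \<nu> m)"
      by (rule nn_integral_Q) measurable
    also have "\<dots> \<le> (\<integral>\<^sup>+z. h (fst z) \<partial>walk_measure \<nu> m)"
      by (intro nn_integral_mono) (auto simp: indicator_def)
    also have "\<dots> = (\<integral>\<^sup>+x. h x \<partial>\<nu>)" by (rule nn_integral_walk_measure_fst) measurable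
    finally show ?thesis .
  qed
qed

lemma set_integral_supported:
  assumes "\<And>x. x \<notin> \<Omega> \<Longrightarrow> f x = (0::real)"
  shows "(LINT x : \<Omega> | \<nu>. f x) = (LINT x|\<nu>. f x)"
  unfolding set_lebesgue_integral_def
  by (intro Bochner_Integration.integral_cong) (auto simp: indicator_def assms)

lemma V_subset_Lp0: "V \<subseteq> Lp0 \<nu> m p \<Omega>"
proof
  fix f assume f: "f \<in> V"
  then have [measurable]: "f \<in> borel_measurable \<nu>" by (rule V_measurable)
  have "set_integrable \<nu> S (\<lambda>x. \<bar>f x\<bar> powr p)"
    unfolding set_integrable_def
    using integrable_mult_indicator[OF sets_S V_integrable_powr[OF f]] by simp
  moreover have "set_borel_measurable \<nu> S f"
    unfolding set_borel_measurable_def by measurable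
  ultimately show "f \<in> Lp0 \<nu> m p \<Omega>"
    using V_zero[OF f] by (auto simp: Lp0_def m_boundary_def)
qed

sublocale coercive_nonlocal_energy \<nu> Q \<Omega> p c
proof
  fix f assume f: "f \<in> V"
  then show "c * (LINT x|\<nu>. \<bar>f x\<bar> powr p) \<le> En f"
    using poincare[of f] V_subset_Lp0 V_zero[OF f]
    by (auto simp: grad_energy_eq[OF V_measurable[OF f]] set_integral_supported)
qed (fact c_pos)

text \<open>Split the gradient of g into its two endpoint values. Exchanging x and y changes the
  sign of the flux, so both parts contribute equally; disintegration then isolates the inner
  integral.\<close>

lemma
  assumes f: "f \<in> V" and g: "g \<in> V"
  shows integrable_mult_flux_divergence:
      "integrable \<nu> (\<lambda>x. g x * flux_divergence \<nu> m p \<Omega> f x)"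
    and Green_formula:
      "1 / 2 * (LINT z|Q. pflux p (grad f z) * grad g z)
        = - (LINT x|\<nu>. g x * flux_divergence \<nu> m p \<Omega> f x)"
proof -
  have [measurable]: "f \<in> borel_measurable \<nu>" "g \<in> borel_measurable \<nu>"
    using f g by (auto intro: V_measurable)
  let ?F = "\<lambda>z. pflux p (grad f z) * g (fst z)"
  have int1: "integrable Q ?F"
    by (intro integrable_pflux_mult integrable_grad_powr f
        integrable_marginals(1)[OF V_integrable_powr[OF g]]) measurable
  have int2: "integrable Q (\<lambda>z. pflux p (grad f z) * g (snd z))"
    by (intro integrable_pflux_mult integrable_grad_powr f
        integrable_marginals(2)[OF V_integrable_powr[OF g]]) measurable
  have swap: "pflux p (grad f z) * g (snd z) = - ?F (snd z, fst z)" for z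
    using pflux_minus[of p "grad f z"] by (simp add: grad_def case_prod_beta)
  have "(LINT z|Q. pflux p (grad f z) * grad g z)
      = (LINT z|Q. pflux p (grad f z) * g (snd z)) - (LINT z|Q. ?F z)"
    using int1 int2
    by (subst Bochner_Integration.integral_diff[symmetric])
      (auto simp: grad_def case_prod_beta right_diff_distrib)
  also have "(LINT z|Q. pflux p (grad f z) * g (snd z)) = - (LINT z|Q. ?F z)"
    unfolding swap using integral_swap[of ?F] by simp
  finally have half: "1 / 2 * (LINT z|Q. pflux p (grad f z) * grad g z) = - (LINT z|Q. ?F z)"
    by simp
  let ?G = "\<lambda>z. indicator (S \<times> S) z * ?F z"
  have int: "integrable (walk_measure \<nu> m) ?G"
    using int1 by (subst (asm) integrable_Q) (auto simp: set_integrable_def)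
  \<comment> \<open>The restriction of x to \<open>S\<close> is absorbed by g x, which vanishes
    outside \<Omega>.\<close>
  have sect: "(LINT y|m x. ?G (x, y)) = g x * flux_divergence \<nu> m p \<Omega> f x" for x
  proof -
    have "(LINT y|m x. ?G (x, y)) = (LINT y|m x. g x * (indicator S y * pflux p (f y - f x)))"
      using V_zero[OF g, of x] Omega_subset_S
      by (intro Bochner_Integration.integral_cong) (auto simp: indicator_def grad_def)
    then show ?thesis by (simp add: flux_divergence_def set_lebesgue_integral_def)
  qed
  show "integrable \<nu> (\<lambda>x. g x * flux_divergence \<nu> m p \<Omega> f x)"
    using integrable_walk_measure_section[OF space_ne int] by (simp only: sect)
  have "(LINT z|Q. ?F z) = (LINT z|walk_measure \<nu> m. ?G z)"
    by (subst integral_Q) (auto simp: set_lebesgue_integral_def)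
  also have "\<dots> = (LINT x|\<nu>. g x * flux_divergence \<nu> m p \<Omega> f x)"
    using integral_walk_measure[OF space_ne int] by (simp only: sect)
  finally show "1 / 2 * (LINT z|Q. pflux p (grad f z) * grad g z)
      = - (LINT x|\<nu>. g x * flux_divergence \<nu> m p \<Omega> f x)"
    using half by simp
qed

text \<open>By Green's formula the weak form says that the residual \<open>R\<close> integrates to 0
  against every g in \<open>V\<close>. Indicators of the subsets of \<Omega> where \<open>R\<close>
  has a fixed sign are admissible and force \<open>R\<close> = 0.\<close>

lemma weak_solution_iff:
  assumes f: "f \<in> V"
  shows "weak_solution f \<longleftrightarrow> (AE x in \<nu>. x \<in> \<Omega> \<longrightarrow> - flux_divergence \<nu> m p \<Omega> f x = 1)"
proof
  assume "AE x in \<nu>. x \<in> \<Omega> \<longrightarrow> - flux_divergence \<nu> m p \<Omega> f x = 1"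
  moreover have "(LINT x|\<nu>. g x) = - (LINT x|\<nu>. g x * flux_divergence \<nu> m p \<Omega> f x)"
    if g: "g \<in> V" and ae: "AE x in \<nu>. x \<in> \<Omega> \<longrightarrow> - flux_divergence \<nu> m p \<Omega> f x = 1" for g
  proof -
    have "AE x in \<nu>. g x = - (g x * flux_divergence \<nu> m p \<Omega> f x)"
      using ae
    proof eventually_elim
      case (elim x)
      then show ?case using V_zero[OF g, of x] by (cases "x \<in> \<Omega>") auto
    qed
    then have "(LINT x|\<nu>. g x) = (LINT x|\<nu>. - (g x * flux_divergence \<nu> m p \<Omega> f x))"
      using integrable_mult_flux_divergence[OF f g] V_measurable[OF g]
      by (intro integral_cong_AE) auto
    then show ?thesis by simp
  qed
  ultimately show "weak_solution f"
    using f Green_formula[OF f] by (simp add: weak_solution_def)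
next
  assume w: "weak_solution f"
  define R where "R x = flux_divergence \<nu> m p \<Omega> f x + 1" for x
  have zero: "AE x in \<nu>. indicator A x * R x = 0"
    if [measurable]: "A \<in> sets \<nu>" and "A \<subseteq> \<Omega>"
      and sign: "(\<forall>x\<in>A. 0 \<le> s * R x) \<and> s \<noteq> 0" for A and s :: real
  proof -
    have A: "indicator A \<in> V" by (rule V_indicator) fact+
    have int: "integrable \<nu> (\<lambda>x. indicator A x * R x)"
      using integrable_mult_flux_divergence[OF f A] V_integrable[OF A]
      by (simp add: R_def distrib_left)
    have "(LINT x|\<nu>. indicator A x * R x)
        = (LINT x|\<nu>. indicator A x * flux_divergence \<nu> m p \<Omega> f x) + (LINT x|\<nu>. indicator A x)"
      using integrable_mult_flux_divergence[OF f A] V_integrable[OF A]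
      by (simp add: R_def distrib_left)
    also have "\<dots> = 0"
      using w A Green_formula[OF f A] by (simp add: weak_solution_def)
    finally have "(LINT x|\<nu>. s * (indicator A x * R x)) = 0" by simp
    then have "AE x in \<nu>. s * (indicator A x * R x) = 0"
      using int sign by (subst (asm) integral_nonneg_eq_0_iff_AE) (auto simp: indicator_def)
    then show ?thesis using sign by simp
  qed
  \<comment> \<open>Measurability is obtained for the residual cut off to \<Omega>, from
    integrability against the test function \<open>indicator \<Omega>\<close>; the sign sets are
    therefore defined by the product.\<close>
  have "(\<lambda>x. indicator \<Omega> x * flux_divergence \<nu> m p \<Omega> f x) \<in> borel_measurable \<nu>"
    using integrable_mult_flux_divergence[OF f V_indicator[of \<Omega>]] by simp
  then have [measurable]: "(\<lambda>x. indicator \<Omega> x * R x) \<in> borel_measurable \<nu>"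
    by (simp add: R_def distrib_left)
  define A where "A = {x \<in> space \<nu>. x \<in> \<Omega> \<and> 0 \<le> indicator \<Omega> x * R x}"
  define B where "B = {x \<in> space \<nu>. x \<in> \<Omega> \<and> indicator \<Omega> x * R x < 0}"
  have "A \<in> sets \<nu>" "B \<in> sets \<nu>" unfolding A_def B_def by measurable
  have "AE x in \<nu>. indicator A x * R x = 0"
    by (rule zero[OF \<open>A \<in> sets \<nu>\<close>, of 1]) (auto simp: A_def)
  moreover have "AE x in \<nu>. indicator B x * R x = 0"
    by (rule zero[OF \<open>B \<in> sets \<nu>\<close>, of "- 1"]) (auto simp: B_def)
  ultimately show "AE x in \<nu>. x \<in> \<Omega> \<longrightarrow> - flux_divergence \<nu> m p \<Omega> f x = 1"
    using AE_space
  proof eventually_elim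
    case (elim x)
    then have "x \<in> \<Omega> \<longrightarrow> R x = 0"
      by (auto simp: A_def B_def indicator_def split: if_splits)
    then show ?case by (auto simp: R_def eq_neg_iff_add_eq_0)
  qed
qed

lemma is_torsional_iff:
  "is_torsional \<nu> m p \<Omega> f \<longleftrightarrow> f \<in> Lp0 \<nu> m p \<Omega> \<and> (AE x in \<nu>. x \<in> S \<longrightarrow> 0 \<le> f x) \<and>
    (AE x in \<nu>. x \<in> \<Omega> \<longrightarrow> - flux_divergence \<nu> m p \<Omega> f x = 1)"
  by (simp add: is_torsional_def flux_divergence_def pflux_def)

lemma ex_torsional: "\<exists>f. is_torsional \<nu> m p \<Omega> f"
proof -
  obtain f where f: "f \<in> V" "\<And>x. 0 \<le> f x" "\<And>g. g \<in> V \<Longrightarrow> J f \<le> J g"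
    by (rule ex_J_minimizer) blast
  have "weak_solution f" using f by (intro J_minimizer_weak_solution)
  then show ?thesis
    using f V_subset_Lp0 by (auto simp: is_torsional_iff weak_solution_iff)
qed

section \<open>Transfer from arbitrary elements of \<open>Lp0\<close> to representatives in
  \<open>V\<close>\<close>

text \<open>
  A function in \<open>L\<^sup>p\<^sub>0\<close> is arbitrary outside \<open>S\<close>, possibly not even measurable there;
  \<open>cut\<close> selects the representative in \<open>V\<close>.
\<close>

definition cut :: "('a \<Rightarrow> real) \<Rightarrow> 'a \<Rightarrow> real" where
  "cut f x = indicator \<Omega> x * f x"

lemma cut_eq_AE:
  assumes "f \<in> Lp0 \<nu> m p \<Omega>"
  shows "AE x in \<nu>. x \<in> S \<longrightarrow> f x = cut f x"
proof -
  have "AE x in \<nu>. x \<in> m_boundary \<nu> m \<Omega> \<longrightarrow> f x = 0"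
    using assms by (simp add: Lp0_def)
  then show ?thesis
    by eventually_elim (auto simp: cut_def m_closure_def indicator_def)
qed

lemma measurable_cut_closure:
  assumes "f \<in> Lp0 \<nu> m p \<Omega>"
  shows "(\<lambda>x. indicator S x * f x) \<in> borel_measurable \<nu>"
  using assms by (simp add: Lp0_def set_borel_measurable_def)

lemma cut_in_V:
  assumes f: "f \<in> Lp0 \<nu> m p \<Omega>"
  shows "cut f \<in> V"
proof -
  note [measurable] = measurable_cut_closure[OF f]
  have "cut f = (\<lambda>x. indicator \<Omega> x * (indicator S x * f x))"
    using Omega_subset_S by (auto simp: cut_def indicator_def fun_eq_iff)
  then have "cut f \<in> borel_measurable \<nu>" by simp
  moreover have "integrable \<nu> (\<lambda>x. \<bar>cut f x\<bar> powr p)"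
  proof -
    have "integrable \<nu> (\<lambda>x. indicator S x *\<^sub>R \<bar>f x\<bar> powr p)"
      using f by (simp add: Lp0_def set_integrable_def)
    from integrable_mult_indicator[OF sets_Omega this] show ?thesis
      by (rule Bochner_Integration.integrable_cong[THEN iffD1, rotated 2])
        (use Omega_subset_S in \<open>auto simp: cut_def indicator_def\<close>)
  qed
  ultimately show ?thesis by (auto simp: supported_Lp_def cut_def)
qed

text \<open>Setting f to 0 outside \<open>S\<close> changes nothing on \<open>S \<times> S\<close>;
  the remaining change is on a \<nu>-null set, which \<open>Q\<close> does not see through either
  marginal.\<close>

lemma grad_energy_cut:
  assumes f: "f \<in> Lp0 \<nu> m p \<Omega>"
  shows "grad_energy \<nu> m p \<Omega> f = En (cut f)"
proof -
  define u where "u x = indicator S x * f x" for x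
  have [measurable]: "u \<in> borel_measurable \<nu>" "cut f \<in> borel_measurable \<nu>"
    using measurable_cut_closure[OF f] V_measurable[OF cut_in_V[OF f]] by (simp_all add: u_def[abs_def])
  have ae: "AE x in \<nu>. u x = cut f x"
    using cut_eq_AE[OF f]
    by eventually_elim (use Omega_subset_S in \<open>auto simp: u_def cut_def indicator_def\<close>)
  have "grad_energy \<nu> m p \<Omega> f = grad_energy \<nu> m p \<Omega> u"
    unfolding grad_energy_def set_lebesgue_integral_def
    by (intro Bochner_Integration.integral_cong)
      (auto simp: u_def grad_def indicator_def)
  also have "\<dots> = En u" by (rule grad_energy_eq) measurable
  also have "\<dots> = En (cut f)"
    unfolding energy_def
  proof (rule integral_cong_AE)
    show "AE z in Q. \<bar>grad u z\<bar> powr p = \<bar>grad (cut f) z\<bar> powr p"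
      using AE_Q_marginals[OF ae] by eventually_elim (simp add: grad_def case_prod_beta)
  qed measurable
  finally show ?thesis .
qed

text \<open>The \<nu>-null set where f and \<open>cut f\<close> differ on \<open>S\<close> is
  m_x-null for almost every x, and at points x of \<Omega> the value f x itself is
  unchanged.\<close>

lemma flux_divergence_cut:
  assumes f: "f \<in> Lp0 \<nu> m p \<Omega>"
  shows "AE x in \<nu>. x \<in> \<Omega> \<longrightarrow>
    flux_divergence \<nu> m p \<Omega> f x = flux_divergence \<nu> m p \<Omega> (cut f) x"
  using AE_kernel[OF space_ne cut_eq_AE[OF f]] AE_space
proof eventually_elim
  case (elim x)
  define u where "u x = indicator S x * f x" for x
  have [measurable]: "u \<in> borel_measurable \<nu>" "cut f \<in> borel_measurable \<nu>"
    using measurable_cut_closure[OF f] V_measurable[OF cut_in_V[OF f]] by (simp_all add: u_def[abs_def])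
  have [measurable]: "u \<in> borel_measurable (m x)" "cut f \<in> borel_measurable (m x)" "S \<in> sets (m x)"
    using measurable_cong_sets[OF sets_kernel[OF \<open>x \<in> space \<nu>\<close>] refl, of borel] \<open>x \<in> space \<nu>\<close> by auto
  show ?case
  proof
    assume "x \<in> \<Omega>"
    then have x: "f x = cut f x" by (simp add: cut_def)
    have "flux_divergence \<nu> m p \<Omega> f x = (LINT y|m x. indicator S y * pflux p (u y - cut f x))"
      unfolding flux_divergence_def set_lebesgue_integral_def x
      by (intro Bochner_Integration.integral_cong) (auto simp: u_def indicator_def)
    also have "\<dots> = (LINT y|m x. indicator S y * pflux p (cut f y - cut f x))"
    proof (rule integral_cong_AE)
      show "AE y in m x. indicator S y * pflux p (u y - cut f x)
          = indicator S y * pflux p (cut f y - cut f x)"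
        using elim(1) by eventually_elim (auto simp: u_def indicator_def)
    qed measurable
    finally show "flux_divergence \<nu> m p \<Omega> f x = flux_divergence \<nu> m p \<Omega> (cut f) x"
      by (simp add: flux_divergence_def set_lebesgue_integral_def)
  qed
qed

lemma set_integral_cut:
  "(LINT x : \<Omega> | \<nu>. f x) = (LINT x|\<nu>. cut f x)"
  "(LINT x : \<Omega> | \<nu>. \<bar>f x\<bar>) = (LINT x|\<nu>. \<bar>cut f x\<bar>)"
  by (auto simp: set_lebesgue_integral_def cut_def abs_mult)

lemma torsion_quotient_cut:
  assumes "f \<in> Lp0 \<nu> m p \<Omega>"
  shows "torsion_quotient \<nu> m p \<Omega> f = (LINT x|\<nu>. \<bar>cut f x\<bar>) powr p / (1 / 2 * En (cut f))"
  by (simp add: torsion_quotient_def set_integral_cut(2) grad_energy_cut[OF assms])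

lemma torsional_weak_solution:
  assumes "is_torsional \<nu> m p \<Omega> f"
  shows "weak_solution (cut f)"
proof -
  have f: "f \<in> Lp0 \<nu> m p \<Omega>" using assms by (simp add: is_torsional_def)
  have "AE x in \<nu>. x \<in> \<Omega> \<longrightarrow> - flux_divergence \<nu> m p \<Omega> f x = 1"
    using assms by (simp add: is_torsional_iff)
  then have "AE x in \<nu>. x \<in> \<Omega> \<longrightarrow> - flux_divergence \<nu> m p \<Omega> (cut f) x = 1"
    using flux_divergence_cut[OF f] by eventually_elim simp
  then show ?thesis by (simp add: weak_solution_iff[OF cut_in_V[OF f]])
qed

text \<open>At f the integral \<open>T\<close> equals half the energy, so the quotient is T^p / T.
  Positivity of \<open>T\<close> also excludes the zero function.\<close>

lemma torsional_maximizes_quotient: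
  assumes f: "is_torsional \<nu> m p \<Omega> f"
  shows "\<not> zero_on \<nu> m \<Omega> f"
    and "(LINT x : \<Omega> | \<nu>. f x) powr (p - 1) = torsion_quotient \<nu> m p \<Omega> f"
    and "g \<in> Lp0 \<nu> m p \<Omega> \<Longrightarrow>
      torsion_quotient \<nu> m p \<Omega> g \<le> (LINT x : \<Omega> | \<nu>. f x) powr (p - 1)"
proof -
  have fL: "f \<in> Lp0 \<nu> m p \<Omega>" using f by (simp add: is_torsional_def)
  have w: "weak_solution (cut f)" by (rule torsional_weak_solution[OF f])
  define T where "T = (LINT x|\<nu>. cut f x)"
  have T: "0 < T" "1 / 2 * En (cut f) = T"
    using weak_solution_integral_pos[OF w pos_Omega] weak_solution_integral[OF w]
    by (auto simp: T_def)
  have nonneg: "AE x in \<nu>. \<bar>cut f x\<bar> = cut f x"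
  proof -
    have "AE x in \<nu>. x \<in> S \<longrightarrow> 0 \<le> f x" using f by (simp add: is_torsional_def)
    then show ?thesis
      by eventually_elim (use Omega_subset_S in \<open>auto simp: cut_def indicator_def\<close>)
  qed
  have [measurable]: "cut f \<in> borel_measurable \<nu>" by (rule V_measurable[OF cut_in_V[OF fL]])
  show "\<not> zero_on \<nu> m \<Omega> f"
  proof
    assume "zero_on \<nu> m \<Omega> f"
    then have "AE x in \<nu>. x \<in> S \<longrightarrow> f x = 0" by (simp add: zero_on_def)
    then have "AE x in \<nu>. cut f x = 0"
      by eventually_elim (use Omega_subset_S in \<open>auto simp: cut_def indicator_def\<close>)
    then have "T = 0" unfolding T_def by (rule integral_eq_zero_AE)
    then show False using T by simp
  qed
  have "(LINT x|\<nu>. \<bar>cut f x\<bar>) = T"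
    unfolding T_def by (rule integral_cong_AE[OF _ _ nonneg]) measurable
  then show "(LINT x : \<Omega> | \<nu>. f x) powr (p - 1) = torsion_quotient \<nu> m p \<Omega> f"
    using T by (simp add: torsion_quotient_cut[OF fL] set_integral_cut(1) powr_diff flip: T_def)
  assume g: "g \<in> Lp0 \<nu> m p \<Omega>"
  have "(LINT x|\<nu>. \<bar>cut g x\<bar>) powr p \<le> T powr (p - 1) * (1 / 2 * En (cut g))"
    unfolding T_def by (rule weak_solution_quotient_bound[OF w cut_in_V[OF g] pos_Omega])
  \<comment> \<open>Zero energy is treated separately: division by 0 gives 0, which is below the
    nonnegative right side.\<close>
  then show "torsion_quotient \<nu> m p \<Omega> g \<le> (LINT x : \<Omega> | \<nu>. f x) powr (p - 1)"
    using energy_nonneg[of "cut g"]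
    by (cases "En (cut g) = 0")
      (simp_all add: torsion_quotient_cut[OF g] set_integral_cut(1) divide_le_eq flip: T_def)
qed

end

theorem theorem6p4:
  fixes \<nu> :: "'a measure" and m :: "'a \<Rightarrow> 'a measure" and \<Omega> :: "'a set" and p :: real
  assumes "1 < p"
    and "reversible_random_walk_space \<nu> m"
    and "\<Omega> \<in> sets \<nu>"
    and "m_connected \<nu> m \<Omega>"
    and "0 < emeasure \<nu> \<Omega>"
    and "emeasure \<nu> \<Omega> < emeasure \<nu> (m_closure \<nu> m \<Omega>)"
    and "emeasure \<nu> (m_closure \<nu> m \<Omega>) < \<infinity>"
    and "poincare_inequality \<nu> m p \<Omega>"
  shows "torsional_function \<nu> m p \<Omega> \<in> Lp0 \<nu> m p \<Omega>
    \<and> \<not> zero_on \<nu> m \<Omega> (torsional_function \<nu> m p \<Omega>)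
    \<and> torsional_rigidity \<nu> m p \<Omega> = torsion_quotient \<nu> m p \<Omega> (torsional_function \<nu> m p \<Omega>)
    \<and> (\<forall>g \<in> Lp0 \<nu> m p \<Omega>. \<not> zero_on \<nu> m \<Omega> g \<longrightarrow>
          torsion_quotient \<nu> m p \<Omega> g \<le> torsional_rigidity \<nu> m p \<Omega>)"
proof -
  obtain c where "0 < c" "\<forall>f \<in> Lp0 \<nu> m p \<Omega>.
      c * (LINT x : \<Omega> | \<nu>. \<bar>f x\<bar> powr p) \<le> grad_energy \<nu> m p \<Omega> f"
    using assms(8) by (auto simp: poincare_inequality_def)
  then interpret torsion_problem \<nu> m \<Omega> p c
    using assms by (intro torsion_problem.intro torsion_problem_axioms.intro) auto
  \<comment> \<open>The properties above hold for an arbitrary torsional function, so the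
    representative chosen by \<open>SOME\<close> is immaterial.\<close>
  have torsional: "is_torsional \<nu> m p \<Omega> (torsional_function \<nu> m p \<Omega>)"
    unfolding torsional_function_def using ex_torsional by (rule someI_ex)
  then have "torsional_function \<nu> m p \<Omega> \<in> Lp0 \<nu> m p \<Omega>"
    by (simp add: is_torsional_def)
  then show ?thesis
    using torsional_maximizes_quotient[OF torsional] by (simp add: torsional_rigidity_def)
qed

end
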